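(* Let $K_1, K_2$ be compact (Hausdorff) spaces such that both admit continuous surjections onto the cube $[0,1]^\kappa$ for some cardinal number $\kappa\ge 1$. Then $\mathcal C(K_1\times K_2)$ contains a complemented subspace isomorphic to $\mathcal C([0,1]^\kappa)$.
   Context: For a compact space $K$, $\mathcal C(K)$ denotes the Banach space of continuous real-valued functions on $K$ with the supremum norm. *)

theory Defs
  imports "HOL-Analysis.Analysis"
begin

text \<open>The Banach space C(K): continuous real functions on the topspace of K,
  normalised to be 0 outside the topspace (so that each element of C(K) is
  represented by exactly one HOL function), with the supremum norm.\<close>

definition cspace :: "'a topology \<Rightarrow> ('a \<Rightarrow> real) set" where
  "cspace X = {f. continuous_map X euclideanreal f \<and> (\<forall>x. x \<notin> topspace X \<longrightarrow> f x = 0)}"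

definition supnorm :: "'a topology \<Rightarrow> ('a \<Rightarrow> real) \<Rightarrow> real" where
  "supnorm X f = (SUP x\<in>topspace X. \<bar>f x\<bar>)"

definition lin_on :: "('a \<Rightarrow> real) set \<Rightarrow> ('b \<Rightarrow> real) set \<Rightarrow> (('a \<Rightarrow> real) \<Rightarrow> ('b \<Rightarrow> real)) \<Rightarrow> bool" where
  "lin_on A B T \<longleftrightarrow> T ` A \<subseteq> B
     \<and> (\<forall>f\<in>A. \<forall>g\<in>A. T (\<lambda>x. f x + g x) = (\<lambda>y. T f y + T g y))
     \<and> (\<forall>c. \<forall>f\<in>A. T (\<lambda>x. c * f x) = (\<lambda>y. c * T f y))"

definition has_complemented_copy :: "'a topology \<Rightarrow> 'b topology \<Rightarrow> bool" where
  "has_complemented_copy X Y \<longleftrightarrow>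
     (\<exists>Z P T.
        Z \<subseteq> cspace X
      \<and> lin_on (cspace X) (cspace X) P
      \<and> (\<exists>C. \<forall>f\<in>cspace X. supnorm X (P f) \<le> C * supnorm X f)
      \<and> P ` cspace X = Z
      \<and> (\<forall>f\<in>Z. P f = f)
      \<and> lin_on (cspace Y) (cspace X) T
      \<and> T ` cspace Y = Z
      \<and> (\<exists>a b. a > 0 \<and> (\<forall>f\<in>cspace Y.
            a * supnorm Y f \<le> supnorm X (T f) \<and> supnorm X (T f) \<le> b * supnorm Y f)))"

definition cube :: "'i set \<Rightarrow> ('i \<Rightarrow> real) topology" where
  "cube I = product_topology (\<lambda>i. top_of_set {0..1}) I"

end

theory Submission
  imports Defs
begin

text \<open>
  Composing the surjections with the quotient map from the cube to the torus and adding in the torus gives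
  a map \<open>w\<close> from \<open>K1 \<times> K2\<close> to the torus, and folding the torus back onto the cube embeds
  \<open>C([0,1]\<^sup>I)\<close> into \<open>C(K1 \<times> K2)\<close>. To find a bounded left inverse, lift Haar measure to positive
  functionals on \<open>K1\<close> and \<open>K2\<close>. For \<open>h = u \<otimes> v\<close> the product functional, disintegrated along \<open>w\<close>,
  is a convolution of two square integrable functions on the torus: by Bessel's inequality its Fourier
  series converges absolutely, so it is a continuous function. Fejer means are contractions, which extends
  the convergence from tensors to all of \<open>C(K1 \<times> K2)\<close>. Restricting the resulting continuous function to
  a section of the folding map is the left inverse.

  No measure theory is needed: the lifted Haar measures are finitely additive means on all bounded functions,
  obtained by compactness from averages over finite grids. Since they apply to indicator functions, the
  approximation by tensors needs no partition of unity.
\<close>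

section \<open>Frequencies and invariant means\<close>

definition freqs :: "'i set \<Rightarrow> ('i \<Rightarrow> int) set" where
  "freqs I = {n. finite {i. n i \<noteq> 0} \<and> {i. n i \<noteq> 0} \<subseteq> I}"

text \<open>The character \<open>n\<close> takes the value \<open>cis (phase n z)\<close> at
  \<open>z\<close>. Only coordinates in the support of \<open>n\<close> enter, so the value
  \<open>undefined\<close> that an extensional point has off \<open>I\<close> is harmless.\<close>

definition phase :: "('i \<Rightarrow> int) \<Rightarrow> ('i \<Rightarrow> real) \<Rightarrow> real" where
  "phase n z = 2 * pi * (\<Sum>i | n i \<noteq> 0. of_int (n i) * z i)"

lemma phase_eq_sum:
  assumes "finite F" "{i. n i \<noteq> 0} \<subseteq> F"
  shows "phase n z = 2 * pi * (\<Sum>i\<in>F. of_int (n i) * z i)"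
  unfolding phase_def using assms by (subst sum.mono_neutral_left[of F]) auto

lemma phase_cong: "(\<And>i. n i \<noteq> 0 \<Longrightarrow> z i = w i) \<Longrightarrow> phase n z = phase n w"
  unfolding phase_def by (auto intro!: sum.cong)

lemma phase_add: "phase n (\<lambda>i. z i + w i) = phase n z + phase n w"
  by (simp add: phase_def distrib_left sum.distrib)

lemma phase_diff: "phase n (\<lambda>i. z i - w i) = phase n z - phase n w"
  by (simp add: phase_def right_diff_distrib sum_subtractf)

lemma phase_0 [simp]: "phase (\<lambda>_. 0) z = 0"
  by (simp add: phase_def)

lemma freqs_0 [simp]: "(\<lambda>_. 0) \<in> freqs I"
  by (simp add: freqs_def)

lemma freqs_minus: "n \<in> freqs I \<Longrightarrow> (\<lambda>i. - n i) \<in> freqs I"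
  by (simp add: freqs_def)

lemma freqs_add:
  assumes "n \<in> freqs I" "k \<in> freqs I"
  shows "(\<lambda>i. n i + k i) \<in> freqs I"
proof -
  have *: "{i. n i + k i \<noteq> 0} \<subseteq> {i. n i \<noteq> 0} \<union> {i. k i \<noteq> 0}" by auto
  have "finite {i. n i + k i \<noteq> 0}"
    by (rule finite_subset[OF *]) (use assms in \<open>auto simp: freqs_def\<close>)
  with * assms show ?thesis by (force simp: freqs_def)
qed

lemma freqs_diff:
  assumes "n \<in> freqs I" "k \<in> freqs I"
  shows "(\<lambda>i. n i - k i) \<in> freqs I"
  using freqs_add[OF assms(1) freqs_minus[OF assms(2)]] by simp

lemma phase_freq_add:
  assumes "n \<in> freqs I" "k \<in> freqs I"
  shows "phase (\<lambda>i. n i + k i) z = phase n z + phase k z"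
proof -
  let ?F = "{i. n i \<noteq> 0} \<union> {i. k i \<noteq> 0}"
  have "finite ?F" using assms by (auto simp: freqs_def)
  then show ?thesis
    by (subst (1 2 3) phase_eq_sum[of ?F]) (auto simp: distrib_right distrib_left sum.distrib)
qed

lemma phase_freq_minus: "phase (\<lambda>i. - n i) z = - phase n z"
  by (simp add: phase_def sum_negf)

lemma phase_freq_diff:
  assumes "n \<in> freqs I" "k \<in> freqs I"
  shows "phase (\<lambda>i. n i - k i) z = phase n z - phase k z"
  using phase_freq_add[OF assms(1) freqs_minus[OF assms(2)]] by (simp add: phase_freq_minus)

section \<open>Finitely additive means on bounded functions\<close>

definition bdd_on :: "'a set \<Rightarrow> ('a \<Rightarrow> real) \<Rightarrow> bool" where
  "bdd_on X f \<longleftrightarrow> (\<exists>B. \<forall>x\<in>X. \<bar>f x\<bar> \<le> B)"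

lemma bdd_onI: "(\<And>x. x \<in> X \<Longrightarrow> \<bar>f x\<bar> \<le> B) \<Longrightarrow> bdd_on X f"
  by (auto simp: bdd_on_def)

lemma bdd_on_const [intro, simp]: "bdd_on X (\<lambda>_. c)"
  by (auto simp: bdd_on_def)

lemma bdd_on_cos [intro, simp]: "bdd_on X (\<lambda>x. cos (f x))"
  by (rule bdd_onI[of _ _ 1]) simp

lemma bdd_on_sin [intro, simp]: "bdd_on X (\<lambda>x. sin (f x))"
  by (rule bdd_onI[of _ _ 1]) simp

lemma bdd_on_add [intro]: "bdd_on X f \<Longrightarrow> bdd_on X g \<Longrightarrow> bdd_on X (\<lambda>x. f x + g x)"
  unfolding bdd_on_def by (meson abs_triangle_ineq add_mono order_trans)

lemma bdd_on_mult [intro]: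
  assumes "bdd_on X f" "bdd_on X g" shows "bdd_on X (\<lambda>x. f x * g x)"
proof -
  from assms obtain A B where "\<And>x. x \<in> X \<Longrightarrow> \<bar>f x\<bar> \<le> A" "\<And>x. x \<in> X \<Longrightarrow> \<bar>g x\<bar> \<le> B"
    by (auto simp: bdd_on_def)
  then have "\<bar>f x * g x\<bar> \<le> A * B" if "x \<in> X" for x
    using that by (simp add: abs_mult) (metis abs_ge_zero mult_mono order_trans)
  then show ?thesis by (rule bdd_onI)
qed

lemma bdd_on_uminus [intro]: "bdd_on X f \<Longrightarrow> bdd_on X (\<lambda>x. - f x)"
  by (simp add: bdd_on_def)

lemma bdd_on_diff [intro]: "bdd_on X f \<Longrightarrow> bdd_on X g \<Longrightarrow> bdd_on X (\<lambda>x. f x - g x)"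
  using bdd_on_add[of X f "\<lambda>x. - g x"] by auto

lemma bdd_on_power [intro]: "bdd_on X f \<Longrightarrow> bdd_on X (\<lambda>x. f x ^ k)"
  by (induction k) auto

lemma bdd_on_sum [intro]: "(\<And>j. j \<in> J \<Longrightarrow> bdd_on X (f j)) \<Longrightarrow> bdd_on X (\<lambda>x. \<Sum>j\<in>J. f j x)"
  by (induction J rule: infinite_finite_induct) auto

lemmas bdd_on_intros = bdd_on_const bdd_on_cos bdd_on_sin bdd_on_add bdd_on_diff
  bdd_on_mult bdd_on_power bdd_on_sum

text \<open>A finitely additive probability on all subsets of \<open>X\<close>, given by its
  integral. The value on functions unbounded on \<open>X\<close> is left open.\<close>

locale mean =
  fixes X :: "'a set" and m :: "('a \<Rightarrow> real) \<Rightarrow> real"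
  assumes add: "bdd_on X f \<Longrightarrow> bdd_on X g \<Longrightarrow> m (\<lambda>x. f x + g x) = m f + m g"
    and scale: "bdd_on X f \<Longrightarrow> m (\<lambda>x. c * f x) = c * m f"
    and nonneg: "bdd_on X f \<Longrightarrow> (\<And>x. x \<in> X \<Longrightarrow> 0 \<le> f x) \<Longrightarrow> 0 \<le> m f"
    and one: "m (\<lambda>_. 1) = 1"
begin

lemma const: "m (\<lambda>_. c) = c"
  using scale[of "\<lambda>_. 1" c] one by simp

lemma diff: "bdd_on X f \<Longrightarrow> bdd_on X g \<Longrightarrow> m (\<lambda>x. f x - g x) = m f - m g"
  using add[of f "\<lambda>x. -1 * g x"] scale[of g "-1"] by auto

lemma mono:
  assumes "bdd_on X f" "bdd_on X g" "\<And>x. x \<in> X \<Longrightarrow> f x \<le> g x"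
  shows "m f \<le> m g"
  using nonneg[of "\<lambda>x. g x - f x"] diff[of g f] assms by auto

text \<open>The axiom \<open>nonneg\<close> looks at \<open>f\<close> on \<open>X\<close> only, so
  \<open>mono\<close> applies in both directions: the values of a HOL function off \<open>X\<close>
  are invisible to a mean.\<close>

lemma cong_on:
  assumes "bdd_on X f" "\<And>x. x \<in> X \<Longrightarrow> f x = g x"
  shows "m f = m g"
proof -
  have "bdd_on X g" using assms by (auto simp: bdd_on_def)
  then show ?thesis using assms by (intro antisym mono) auto
qed

lemma sum: "(\<And>j. j \<in> J \<Longrightarrow> bdd_on X (f j)) \<Longrightarrow> m (\<lambda>x. \<Sum>j\<in>J. f j x) = (\<Sum>j\<in>J. m (f j))"
proof (induction J rule: infinite_finite_induct)
  case (insert a J)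
  then show ?case using add[of "f a" "\<lambda>x. \<Sum>j\<in>J. f j x"] by auto
qed (simp_all add: const)

lemma abs_le:
  assumes "bdd_on X f" "bdd_on X g" "\<And>x. x \<in> X \<Longrightarrow> \<bar>f x\<bar> \<le> g x"
  shows "\<bar>m f\<bar> \<le> m g"
proof -
  have "m f \<le> m g" using assms by (intro mono) (auto dest: abs_le_D1)
  moreover have "m (\<lambda>x. -1 * f x) \<le> m g"
    using assms by (intro mono) (auto dest: abs_le_D2)
  ultimately show ?thesis using scale[of f "-1"] assms(1) by auto
qed

lemma abs_bound:
  assumes "\<And>x. x \<in> X \<Longrightarrow> \<bar>f x\<bar> \<le> B"
  shows "\<bar>m f\<bar> \<le> B"
  using abs_le[of f "\<lambda>_. B"] bdd_onI[of X f B] assms by (simp add: const)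

end

section \<open>Equidistribution and averages over finite grids\<close>

text \<open>The image of \<open>m\<close> under \<open>g\<close> is Haar measure on the torus \<open>(\<real>/\<int>)\<^sup>I\<close>, expressed by Fourier coefficients.\<close>

definition equidistributed :: "'i set \<Rightarrow> (('a \<Rightarrow> real) \<Rightarrow> real) \<Rightarrow> ('a \<Rightarrow> 'i \<Rightarrow> real) \<Rightarrow> bool" where
  "equidistributed I m g \<longleftrightarrow>
     (\<forall>n\<in>freqs I. n \<noteq> (\<lambda>_. 0) \<longrightarrow> (\<forall>c. m (\<lambda>x. cos (phase n (g x) + c)) = 0))"

text \<open>This box serves twice: the points \<open>p / N\<close> are the \<open>N\<close>-torsion
  points of the torus in the coordinates \<open>F\<close>, and later the \<open>p\<close> themselves
  are the frequencies from which the Fejer kernel is built.\<close>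

definition grid :: "'i set \<Rightarrow> nat \<Rightarrow> ('i \<Rightarrow> int) set" where
  "grid F N = F \<rightarrow>\<^sub>E {0..<int N}"

lemma finite_grid: "finite F \<Longrightarrow> finite (grid F N)"
  unfolding grid_def by (rule finite_PiE) auto

lemma card_grid: "finite F \<Longrightarrow> card (grid F N) = N ^ card F"
  unfolding grid_def by (simp add: card_PiE)

text \<open>A geometric sum with ratio \<open>w\<close> where \<open>w ^ N = 1\<close>; the bounds
  on \<open>a\<close> exclude multiples of \<open>N\<close>, so \<open>w \<noteq> 1\<close>.\<close>

lemma sum_roots_of_unity_eq_0:
  assumes "0 < \<bar>a\<bar>" "\<bar>a\<bar> < int N"
  shows "(\<Sum>j\<in>{0..<int N}. cis (2 * pi * (of_int a * (of_int j / of_nat N)))) = 0"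
proof -
  define w where "w = cis (2 * pi * of_int a / of_nat N)"
  have N: "N > 0" using assms by auto
  have "w \<noteq> 1"
  proof
    assume "w = 1"
    then have "cos (2 * pi * of_int a / of_nat N) = 1" by (simp add: w_def complex_eq_iff)
    then obtain k :: int where "2 * pi * of_int a / of_nat N = of_int k * 2 * pi"
      by (auto simp: cos_one_2pi_int)
    then have "real_of_int a = of_int (k * int N)" using N by (simp add: field_simps)
    then have a: "a = k * int N" by linarith
    then have "k \<noteq> 0" using assms by auto
    then have "int N \<le> \<bar>a\<bar>" using a using N by (simp add: abs_mult mult_le_cancel_right1)
    then show False using assms by simp
  qed
  have "w ^ N = cis (2 * pi * of_int a)"
    using N Complex.DeMoivre[of "2 * pi * of_int a / of_nat N" N] by (simp add: w_def)
  also have "\<dots> = 1" using cis_multiple_2pi[of "of_int a"] by simp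
  finally have 1: "w ^ N = 1" .
  have "(\<Sum>j\<in>{0..<int N}. cis (2 * pi * (of_int a * (of_int j / of_nat N)))) = (\<Sum>j<N. w ^ j)"
    by (rule sum.reindex_bij_witness[of _ int nat]) (auto simp: w_def Complex.DeMoivre mult_ac)
  also have "\<dots> = 0" using \<open>w \<noteq> 1\<close> 1 by (simp add: geometric_sum)
  finally show ?thesis .
qed

lemma cis_sum_eq: "cis (\<Sum>i\<in>F. f i) = (\<Prod>i\<in>F. cis (f i))"
  by (induction F rule: infinite_finite_induct) (auto simp: cis_mult[symmetric])

text \<open>The character sum over the box factors into one sum of roots of unity per coordinate,
  and a coordinate with \<open>n i \<noteq> 0\<close> contributes the factor 0. The shift
  \<open>c\<close> is a rotation by \<open>cis c\<close> before taking real parts.\<close>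

lemma sum_grid_eq_0:
  assumes F: "finite F" "{i. n i \<noteq> 0} \<subseteq> F" and n: "n \<noteq> (\<lambda>_. 0)"
    and small: "\<And>i. i \<in> F \<Longrightarrow> \<bar>n i\<bar> < int N"
  shows "(\<Sum>p\<in>grid F N. cos (phase n (\<lambda>i. of_int (p i) / of_nat N) + c)) = 0"
proof -
  from n obtain i where i: "n i \<noteq> 0" by auto
  have "(\<Sum>p\<in>grid F N. cis (phase n (\<lambda>i. of_int (p i) / of_nat N)))
      = (\<Sum>p\<in>grid F N. \<Prod>i\<in>F. cis (2 * pi * (of_int (n i) * (of_int (p i) / of_nat N))))"
    using F by (intro sum.cong) (auto simp: phase_eq_sum cis_sum_eq sum_distrib_left)
  also have "\<dots> = (\<Prod>i\<in>F. \<Sum>j\<in>{0..<int N}. cis (2 * pi * (of_int (n i) * (of_int j / of_nat N))))"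
    unfolding grid_def using F by (subst prod_sum_PiE) auto
  also have "\<dots> = 0"
    using F i small[of i] by (intro prod_zero bexI[of _ i] sum_roots_of_unity_eq_0) auto
  finally have "cis c * (\<Sum>p\<in>grid F N. cis (phase n (\<lambda>i. of_int (p i) / of_nat N))) = 0"
    by simp
  then have "(\<Sum>p\<in>grid F N. cis (phase n (\<lambda>i. of_int (p i) / of_nat N) + c)) = 0"
    by (simp add: sum_distrib_left cis_mult add.commute)
  then have "Re (\<Sum>p\<in>grid F N. cis (phase n (\<lambda>i. of_int (p i) / of_nat N) + c)) = 0" by simp
  then show ?thesis by (simp add: Re_sum)
qed

text \<open>For finitely many frequencies the average over a fine grid already agrees with Haar
  measure; surjectivity lifts the grid points to \<open>X\<close>. The last conclusion fixes the
  value on unbounded functions, so that the means obtained lie in one compact product of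
  intervals.\<close>

lemma grid_mean_exists:
  fixes g :: "'a \<Rightarrow> 'i \<Rightarrow> real"
  assumes g: "\<And>a. a \<in> (\<Pi>\<^sub>E i\<in>I. {0..1}) \<Longrightarrow> \<exists>x\<in>X. g x = a"
    and M: "finite M" "M \<subseteq> freqs I - {\<lambda>_. 0}"
  obtains m where "mean X m" "\<And>n c. n \<in> M \<Longrightarrow> m (\<lambda>x. cos (phase n (g x) + c)) = 0"
    "\<And>f. \<not> bdd_on X f \<Longrightarrow> m f = 0"
proof -
  define F where "F = (\<Union>n\<in>M. {i. n i \<noteq> 0})"
  have F: "finite F" "F \<subseteq> I" using M by (auto simp: F_def freqs_def)
  \<comment> \<open>\<open>N\<close> exceeds every entry of every frequency in \<open>M\<close>, so
    no nonzero entry is a multiple of \<open>N\<close>; \<open>Suc\<close> also makes the grid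
    nonempty.\<close>
  define N where "N = Suc (\<Sum>n\<in>M. \<Sum>i\<in>F. nat \<bar>n i\<bar>)"
  have N: "\<bar>n i\<bar> < int N" if "n \<in> M" "i \<in> F" for n i
  proof -
    have "nat \<bar>n i\<bar> \<le> (\<Sum>i\<in>F. nat \<bar>n i\<bar>)" using F that by (intro member_le_sum) auto
    also have "\<dots> \<le> (\<Sum>n\<in>M. \<Sum>i\<in>F. nat \<bar>n i\<bar>)" 
      using that M by (intro member_le_sum[where f = "\<lambda>n. \<Sum>i\<in>F. nat \<bar>n i\<bar>"]) auto
    finally show ?thesis unfolding N_def by linarith
  qed
  have "\<exists>x\<in>X. \<forall>i\<in>F. g x i = of_int (p i) / of_nat N" if "p \<in> grid F N" for p
  proof -
    \<comment> \<open>The frequencies in \<open>M\<close> do not see the coordinates off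
      \<open>F\<close>; the value 0 there merely places the point in the cube.\<close>
    have "(\<lambda>i\<in>I. if i \<in> F then of_int (p i) / of_nat N else 0) \<in> (\<Pi>\<^sub>E i\<in>I. {0..1::real})"
      using that by (fastforce simp: grid_def PiE_iff divide_le_eq_1)
    from g[OF this] F show ?thesis by (force simp: restrict_def)
  qed
  then obtain \<xi> where \<xi>: "\<And>p. p \<in> grid F N \<Longrightarrow> \<xi> p \<in> X"
    "\<And>p i. p \<in> grid F N \<Longrightarrow> i \<in> F \<Longrightarrow> g (\<xi> p) i = of_int (p i) / of_nat N"
    by metis
  define m where "m f = (if bdd_on X f then (\<Sum>p\<in>grid F N. f (\<xi> p)) / card (grid F N) else 0)" for f
  have pos: "card (grid F N) > 0" using F by (simp add: card_grid N_def)
  show ?thesis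
  proof
    show "mean X m"
      by unfold_locales
        (use pos \<xi>(1) in \<open>auto simp: m_def sum.distrib sum_distrib_left add_divide_distrib bdd_on_add bdd_on_mult
            intro!: divide_nonneg_nonneg sum_nonneg\<close>)
    fix n c assume n: "n \<in> M"
    then have sub: "{i. n i \<noteq> 0} \<subseteq> F" by (auto simp: F_def)
    have "(\<Sum>p\<in>grid F N. cos (phase n (g (\<xi> p)) + c))
      = (\<Sum>p\<in>grid F N. cos (phase n (\<lambda>i. of_int (p i) / of_nat N) + c))"
    proof (intro sum.cong refl)
      fix p assume "p \<in> grid F N"
      then have "phase n (g (\<xi> p)) = phase n (\<lambda>i. of_int (p i) / of_nat N)"
        using \<xi>(2) sub by (intro phase_cong) auto
      then show "cos (phase n (g (\<xi> p)) + c) = cos (phase n (\<lambda>i. of_int (p i) / of_nat N) + c)" by simp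
    qed
    also have "\<dots> = 0" using F sub n M N by (intro sum_grid_eq_0) auto
    finally show "m (\<lambda>x. cos (phase n (g x) + c)) = 0" by (simp add: m_def)
  qed (simp add: m_def)
qed

section \<open>Lifting Haar measure by compactness\<close>

lemma continuous_on_apply [continuous_intros]: "continuous_on S (\<lambda>m::'a \<Rightarrow> real. m f)"
  by (rule continuous_on_subset[OF continuous_on_product_coordinates]) auto

lemma closed_Collect_imp_const: "closed {x. Q x} \<Longrightarrow> closed {x. P \<longrightarrow> Q x}"
  by (cases P) auto

text \<open>Each axiom of a mean compares finitely many evaluations \<open>m f\<close>, and these
  are continuous in \<open>m\<close> for pointwise convergence.\<close>

lemma closed_means: "closed {m. mean X m}"
proof -
  have eq: "{m. mean X m} = {m. (\<forall>f g. bdd_on X f \<and> bdd_on X g \<longrightarrow> m (\<lambda>x. f x + g x) = m f + m g) \<and>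
      (\<forall>f c. bdd_on X f \<longrightarrow> m (\<lambda>x. c * f x) = c * m f) \<and>
      (\<forall>f. bdd_on X f \<and> (\<forall>x\<in>X. 0 \<le> f x) \<longrightarrow> 0 \<le> m f) \<and> m (\<lambda>_. 1) = 1}"
    unfolding mean_def by blast
  show ?thesis unfolding eq
    by (intro closed_Collect_conj closed_Collect_all closed_Collect_imp_const
        closed_Collect_eq closed_Collect_le continuous_intros)
qed

text \<open>By Tychonoff, the means bounded by \<open>B\<close> form a compact set. Each nonzero
  frequency imposes a closed condition, and \<open>grid_mean_exists\<close> meets any finite number
  of them.\<close>

lemma mean_exists:
  fixes g :: "'a \<Rightarrow> 'i \<Rightarrow> real"
  assumes g: "\<And>a. a \<in> (\<Pi>\<^sub>E i\<in>I. {0..1}) \<Longrightarrow> \<exists>x\<in>X. g x = a"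
  obtains m where "mean X m" "equidistributed I m g"
proof -
  \<comment> \<open>Every HOL function gets an interval; that of an unbounded one is
    \<open>{0}\<close>, matching the default value of the grid means.\<close>
  define B where "B f = (if bdd_on X f then SOME B. \<forall>x\<in>X. \<bar>f x\<bar> \<le> B else 0)" for f
  have B: "\<bar>f x\<bar> \<le> B f" if "bdd_on X f" "x \<in> X" for f x
    using that someI_ex[of "\<lambda>B. \<forall>x\<in>X. \<bar>f x\<bar> \<le> B"] by (auto simp: B_def bdd_on_def)
  define C where "C = (\<Pi>\<^sub>E f\<in>UNIV. {-B f..B f})"
  have "compactin (product_topology (\<lambda>_. euclideanreal) UNIV) C"
    unfolding C_def compactin_PiE by simp
  then have C: "compact C" by (simp add: euclidean_product_topology)
  define Z where "Z n = {m :: ('a \<Rightarrow> real) \<Rightarrow> real. \<forall>c. m (\<lambda>x. cos (phase n (g x) + c)) = 0}" for n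
  have "(C \<inter> {m. mean X m}) \<inter> (\<Inter>n\<in>freqs I - {\<lambda>_. 0}. Z n) \<noteq> {}"
  proof (rule compact_imp_fip_image)
    show "compact (C \<inter> {m. mean X m})" by (intro compact_Int_closed C closed_means)
    show "closed (Z n)" for n
      unfolding Z_def by (intro closed_Collect_all closed_Collect_eq continuous_intros)
    fix M assume M: "finite M" "M \<subseteq> freqs I - {\<lambda>_. 0}"
    from grid_mean_exists[OF g M] obtain m where m: "mean X m"
      "\<And>n c. n \<in> M \<Longrightarrow> m (\<lambda>x. cos (phase n (g x) + c)) = 0" "\<And>f. \<not> bdd_on X f \<Longrightarrow> m f = 0"
      by blast
    have "\<bar>m f\<bar> \<le> B f" for f
    proof (cases "bdd_on X f")
      case True
      then show ?thesis using mean.abs_bound[OF m(1)] B by blast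
    qed (simp add: m(3) B_def)
    then have "m \<in> C" by (auto simp: C_def abs_le_iff minus_le_iff)
    with m show "C \<inter> {m. mean X m} \<inter> (\<Inter>n\<in>M. Z n) \<noteq> {}" by (auto simp: Z_def)
  qed
  then obtain m where "mean X m" "\<And>n. n \<in> freqs I - {\<lambda>_. 0} \<Longrightarrow> m \<in> Z n" by auto
  then show thesis by (intro that[of m]) (auto simp: equidistributed_def Z_def)
qed

section \<open>Fejer means\<close>

text \<open>The relative overlap of the frequency box with its translate by \<open>n\<close>; in one
  dimension this is the Fejer weight \<open>1 - \<bar>n\<bar> / N\<close>. As grid points are
  extensional, a nonzero overlap forces \<open>n\<close> to vanish off \<open>F\<close>.\<close>

definition fejer_coeff :: "'i set \<Rightarrow> nat \<Rightarrow> ('i \<Rightarrow> int) \<Rightarrow> real" where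
  "fejer_coeff F N n = card {q \<in> grid F N. (\<lambda>i. q i + n i) \<in> grid F N} / card (grid F N)"

definition grid_diffs :: "'i set \<Rightarrow> nat \<Rightarrow> ('i \<Rightarrow> int) set" where
  "grid_diffs F N = (\<lambda>(p, q) i. p i - q i) ` (grid F N \<times> grid F N)"

text \<open>The kernel \<open>\<bar>\<Sum>p. cis (phase p z)\<bar>\<^sup>2 / card\<close>, summed over the grid. A grid point is undefined off \<open>F\<close>,
  but the differences vanish there, so they are frequencies.\<close>

definition fejer :: "'i set \<Rightarrow> nat \<Rightarrow> ('i \<Rightarrow> real) \<Rightarrow> real" where
  "fejer F N z = (\<Sum>p\<in>grid F N. \<Sum>q\<in>grid F N. cos (phase (\<lambda>i. p i - q i) z)) / card (grid F N)"

lemma grid_diff_support: "p \<in> grid F N \<Longrightarrow> q \<in> grid F N \<Longrightarrow> {i. p i - q i \<noteq> 0} \<subseteq> F"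
  using PiE_arb[of p F "\<lambda>_. {0..<int N}"] PiE_arb[of q F "\<lambda>_. {0..<int N}"]
  unfolding grid_def by force

lemma finite_grid_diffs: "finite F \<Longrightarrow> finite (grid_diffs F N)"
  by (simp add: grid_diffs_def finite_grid)

lemma grid_diffs_subset: "finite F \<Longrightarrow> F \<subseteq> I \<Longrightarrow> grid_diffs F N \<subseteq> freqs I"
proof
  assume F: "finite F" "F \<subseteq> I"
  fix n assume "n \<in> grid_diffs F N"
  then obtain p q where "n = (\<lambda>i. p i - q i)" "p \<in> grid F N" "q \<in> grid F N"
    by (auto simp: grid_diffs_def)
  then have "{i. n i \<noteq> 0} \<subseteq> F" using grid_diff_support[of p F N q] by simp
  then show "n \<in> freqs I" using F by (auto simp: freqs_def intro: finite_subset)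
qed

lemma zero_in_grid_diffs: "N > 0 \<Longrightarrow> (\<lambda>_. 0) \<in> grid_diffs F N"
proof -
  assume "N > 0"
  then have "(\<lambda>i\<in>F. 0) \<in> grid F N" by (auto simp: grid_def)
  then show ?thesis unfolding grid_diffs_def by force
qed

lemma fejer_coeff_nonneg: "0 \<le> fejer_coeff F N n"
  by (simp add: fejer_coeff_def)

lemma fejer_coeff_le_1:
  assumes "finite F" shows "fejer_coeff F N n \<le> 1"
proof -
  have "card {q \<in> grid F N. (\<lambda>i. q i + n i) \<in> grid F N} \<le> card (grid F N)"
    using finite_grid[OF assms] by (intro card_mono) auto
  then show ?thesis unfolding fejer_coeff_def by (intro divide_le_eq_1[THEN iffD2]) (auto simp del: of_nat_eq_0_iff)
qed

lemma fejer_coeff_eq_0: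
  assumes "n \<notin> grid_diffs F N" shows "fejer_coeff F N n = 0"
proof -
  have "q \<notin> grid F N" if "(\<lambda>i. q i + n i) \<in> grid F N" for q
  proof
    assume "q \<in> grid F N"
    then have "(\<lambda>(p, q) i. p i - q i) (\<lambda>i. q i + n i, q) \<in> grid_diffs F N"
      unfolding grid_diffs_def using that by blast
    with assms show False by simp
  qed
  then have eq: "{q \<in> grid F N. (\<lambda>i. q i + n i) \<in> grid F N} = {}" by auto
  show ?thesis unfolding fejer_coeff_def eq by simp
qed

lemma fejer_coeff_zero: "finite F \<Longrightarrow> N > 0 \<Longrightarrow> fejer_coeff F N (\<lambda>_. 0) = 1"
  by (simp add: fejer_coeff_def card_grid)

text \<open>Group the double sum by the difference \<open>n = p - q\<close>: a pair with difference
  \<open>n\<close> is determined by \<open>q\<close>, which ranges over the overlap counted in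
  \<open>fejer_coeff\<close>.\<close>

lemma fejer_expand:
  assumes "finite F"
  shows "fejer F N z = (\<Sum>n\<in>grid_diffs F N. fejer_coeff F N n * cos (phase n z))"
proof -
  let ?G = "grid F N" and ?d = "\<lambda>(p, q) i. p i - q i :: int"
  have fin: "finite (?G \<times> ?G)" using finite_grid[OF assms] by auto
  have "(\<Sum>p\<in>?G. \<Sum>q\<in>?G. cos (phase (\<lambda>i. p i - q i) z)) = (\<Sum>x\<in>?G \<times> ?G. cos (phase (?d x) z))"
    by (simp add: sum.cartesian_product case_prod_unfold)
  also have "\<dots> = (\<Sum>n\<in>grid_diffs F N. \<Sum>x | x \<in> ?G \<times> ?G \<and> ?d x = n. cos (phase (?d x) z))"
    unfolding grid_diffs_def by (rule sum.image_gen[OF fin])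
  also have "\<dots> = (\<Sum>n\<in>grid_diffs F N. card {q \<in> ?G. (\<lambda>i. q i + n i) \<in> ?G} * cos (phase n z))"
  proof (intro sum.cong refl)
    fix n
    have "(\<Sum>x | x \<in> ?G \<times> ?G \<and> ?d x = n. cos (phase (?d x) z)) 
        = card {x. x \<in> ?G \<times> ?G \<and> ?d x = n} * cos (phase n z)" by simp
    also have "card {x. x \<in> ?G \<times> ?G \<and> ?d x = n} = card {q \<in> ?G. (\<lambda>i. q i + n i) \<in> ?G}"
      by (rule bij_betw_same_card[of snd], rule bij_betw_byWitness[of _ "\<lambda>q. (\<lambda>i. q i + n i, q)"]) auto
    finally show "(\<Sum>x | x \<in> ?G \<times> ?G \<and> ?d x = n. cos (phase (?d x) z)) =
        card {q \<in> ?G. (\<lambda>i. q i + n i) \<in> ?G} * cos (phase n z)" .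
  qed
  finally show ?thesis
    by (simp add: fejer_def fejer_coeff_def sum_divide_distrib)
qed

text \<open>The double sum of \<open>cos (P p - P q)\<close> is the squared modulus of the sum of
  \<open>cis (P p)\<close>.\<close>

lemma fejer_nonneg:
  assumes "finite F" shows "0 \<le> fejer F N z"
proof -
  let ?G = "grid F N" 
  \<comment> \<open>The phase of \<open>p\<close> restricted to \<open>F\<close>;
    \<open>phase p\<close> itself would see the value \<open>undefined\<close> off
    \<open>F\<close>.\<close>
  define P where "P p = 2 * pi * (\<Sum>i\<in>F. of_int (p i) * z i)" for p :: "'a \<Rightarrow> int"
  have "phase (\<lambda>i. p i - q i) z = P p - P q" if "p \<in> ?G" "q \<in> ?G" for p q
    using phase_eq_sum[OF assms grid_diff_support[OF that]]
    by (simp add: P_def right_diff_distrib left_diff_distrib sum_subtractf)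
  then have "(\<Sum>p\<in>?G. \<Sum>q\<in>?G. cos (phase (\<lambda>i. p i - q i) z)) = (\<Sum>p\<in>?G. \<Sum>q\<in>?G. cos (P p - P q))"
    by (intro sum.cong) auto
  also have "\<dots> = (\<Sum>p\<in>?G. cos (P p))\<^sup>2 + (\<Sum>p\<in>?G. sin (P p))\<^sup>2"
    by (simp add: cos_diff power2_eq_square sum_product sum.distrib)
  finally show ?thesis by (simp add: fejer_def)
qed

text \<open>\<open>I\<close> may have any cardinality, so the Fejer means form a net: the finite
  coordinate set grows and the side length tends to infinity.\<close>

definition fejer_filter :: "'i set \<Rightarrow> ('i set \<times> nat) filter" where
  "fejer_filter I = finite_subsets_at_top I \<times>\<^sub>F sequentially"

lemma fejer_filter_neq_bot: "fejer_filter I \<noteq> bot"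
  by (simp add: fejer_filter_def prod_filter_eq_bot)

lemma eventually_fejer_filter:
  assumes "finite J" "J \<subseteq> I"
  shows "\<forall>\<^sub>F (F, N) in fejer_filter I. finite F \<and> J \<subseteq> F \<and> F \<subseteq> I \<and> N \<ge> N0"
proof -
  have "\<forall>\<^sub>F F in finite_subsets_at_top I. finite F \<and> J \<subseteq> F \<and> F \<subseteq> I"
    using assms unfolding eventually_finite_subsets_at_top by blast
  from eventually_prodI[OF this eventually_ge_at_top[of N0]]
  show ?thesis unfolding fejer_filter_def by (rule eventually_mono) auto
qed

lemma eventually_fejer_filter_finite:
  "\<forall>\<^sub>F (F, N) in fejer_filter I. finite F \<and> F \<subseteq> I \<and> N > 0"
  by (rule eventually_mono[OF eventually_fejer_filter[of "{}" I 1]]) auto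

text \<open>The overlap of the two boxes is a box with sides \<open>N - \<bar>n i\<bar>\<close>; by
  \<open>small\<close> the truncation in \<open>nat\<close> loses nothing. Coordinates with
  \<open>n i = 0\<close> give the factor 1, which removes the dependence on
  \<open>F\<close>.\<close>

lemma fejer_coeff_eq_prod:
  assumes "finite F" "{i. n i \<noteq> 0} \<subseteq> F" "N > 0" and small: "\<And>i. \<bar>n i\<bar> \<le> int N"
  shows "fejer_coeff F N n = (\<Prod>i | n i \<noteq> 0. 1 - \<bar>of_int (n i)\<bar> / of_nat N)"
proof -
  have 0: "n i = 0" if "i \<notin> F" for i using assms(2) that by auto
  have "{q \<in> grid F N. (\<lambda>i. q i + n i) \<in> grid F N} 
    = (\<Pi>\<^sub>E i\<in>F. {max 0 (- n i)..<min (int N) (int N - n i)})"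
    using 0 by (fastforce simp: grid_def PiE_iff extensional_def)
  then have "real (card {q \<in> grid F N. (\<lambda>i. q i + n i) \<in> grid F N})
    = (\<Prod>i\<in>F. real (nat (min (int N) (int N - n i) - max 0 (- n i))))"
    using assms(1) by (simp add: card_PiE)
  also have "\<dots> = (\<Prod>i\<in>F. real N * (1 - \<bar>of_int (n i)\<bar> / of_nat N))"
  proof (intro prod.cong refl)
    fix i
    have "min (int N) (int N - n i) - max 0 (- n i) = int N - \<bar>n i\<bar>" by (auto simp: min_def max_def)
    then have "real (nat (min (int N) (int N - n i) - max 0 (- n i))) = real_of_int (int N - \<bar>n i\<bar>)"
      using small[of i] by simp
    then show "real (nat (min (int N) (int N - n i) - max 0 (- n i))) = real N * (1 - \<bar>of_int (n i)\<bar> / of_nat N)"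
      using assms(3) by (simp add: right_diff_distrib)
  qed
  finally have "fejer_coeff F N n = (\<Prod>i\<in>F. 1 - \<bar>of_int (n i)\<bar> / of_nat N)"
    using assms(1,3) by (simp add: fejer_coeff_def card_grid prod.distrib)
  also have "\<dots> = (\<Prod>i | n i \<noteq> 0. 1 - \<bar>of_int (n i)\<bar> / of_nat N)"
    using assms(1,2) by (intro prod.mono_neutral_right) auto
  finally show ?thesis .
qed

text \<open>Once \<open>F\<close> contains the support of \<open>n\<close>, the coefficient is a
  product of a fixed finite number of factors, each tending to 1.\<close>

lemma fejer_coeff_tendsto:
  assumes "n \<in> freqs I"
  shows "((\<lambda>(F, N). fejer_coeff F N n) \<longlongrightarrow> 1) (fejer_filter I)"
proof -
  define J where "J = {i. n i \<noteq> 0}"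
  have J: "finite J" "J \<subseteq> I" using assms by (auto simp: J_def freqs_def)
  define N0 where "N0 = Suc (\<Sum>i\<in>J. nat \<bar>n i\<bar>)"
  have N0: "\<bar>n i\<bar> \<le> int N0" for i
  proof (cases "i \<in> J")
    case True
    then have "nat \<bar>n i\<bar> \<le> (\<Sum>i\<in>J. nat \<bar>n i\<bar>)" using J by (intro member_le_sum) auto
    then show ?thesis unfolding N0_def by linarith
  qed (simp add: J_def)
  have "(\<lambda>N. \<Prod>i\<in>J. 1 - \<bar>of_int (n i)\<bar> / of_nat N) \<longlonglongrightarrow> (\<Prod>i\<in>J. 1 - 0 :: real)"
    by (intro tendsto_intros lim_const_over_n)
  then have "((\<lambda>A. \<Prod>i\<in>J. 1 - \<bar>of_int (n i)\<bar> / of_nat (snd A)) \<longlongrightarrow> (1::real)) (fejer_filter I)"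
    unfolding fejer_filter_def by (intro filterlim_compose[OF _ filterlim_snd]) auto
  moreover have "\<forall>\<^sub>F A in fejer_filter I. (\<Prod>i\<in>J. 1 - \<bar>of_int (n i)\<bar> / of_nat (snd A)) =
     (case A of (F, N) \<Rightarrow> fejer_coeff F N n)"
  proof (rule eventually_mono[OF eventually_fejer_filter[OF J, of N0]], clarify)
    fix F N assume A: "finite F" "J \<subseteq> F" "N0 \<le> N"
    have "\<bar>n i\<bar> \<le> int N" for i using N0[of i] A(3) by simp
    moreover have "N > 0" using A(3) by (simp add: N0_def)
    ultimately show "(\<Prod>i\<in>J. 1 - \<bar>of_int (n i)\<bar> / of_nat (snd (F, N))) = fejer_coeff F N n"
      using fejer_coeff_eq_prod[of F n N] A by (simp add: J_def)
  qed
  ultimately show ?thesis by (rule Lim_transform_eventually)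
qed

section \<open>Products of means and addition in the torus\<close>

lemma mean_prod:
  assumes "mean X m1" "mean Y m2"
  shows "mean (X \<times> Y) (\<lambda>h. m1 (\<lambda>x. m2 (\<lambda>y. h (x, y))))"
proof -
  interpret m1: mean X m1 by fact
  interpret m2: mean Y m2 by fact
  have sec: "bdd_on Y (\<lambda>y. f (x, y))" if "bdd_on (X \<times> Y) f" "x \<in> X" for f x
    using that by (auto simp: bdd_on_def)
  have int: "bdd_on X (\<lambda>x. m2 (\<lambda>y. f (x, y)))" if f: "bdd_on (X \<times> Y) f" for f
  proof -
    from f obtain B where B: "\<And>v. v \<in> X \<times> Y \<Longrightarrow> \<bar>f v\<bar> \<le> B" unfolding bdd_on_def by blast
    show ?thesis by (rule bdd_onI[of _ _ B]) (auto intro!: m2.abs_bound B)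
  qed
  show ?thesis
  proof
    fix f g :: "'a \<times> 'b \<Rightarrow> real" and c
    assume f: "bdd_on (X \<times> Y) f"
    show "m1 (\<lambda>x. m2 (\<lambda>y. c * f (x, y))) = c * m1 (\<lambda>x. m2 (\<lambda>y. f (x, y)))"
      using int[OF f] by (subst m1.scale[symmetric]) (auto intro!: m1.cong_on m2.scale sec f int bdd_on_mult)
    show "0 \<le> m1 (\<lambda>x. m2 (\<lambda>y. f (x, y)))" if "\<And>v. v \<in> X \<times> Y \<Longrightarrow> 0 \<le> f v"
      using that by (intro m1.nonneg int f m2.nonneg sec) auto
    assume g: "bdd_on (X \<times> Y) g"
    show "m1 (\<lambda>x. m2 (\<lambda>y. f (x, y) + g (x, y))) = m1 (\<lambda>x. m2 (\<lambda>y. f (x, y))) + m1 (\<lambda>x. m2 (\<lambda>y. g (x, y)))"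
      using int[OF f] int[OF g] 
      by (subst m1.add[symmetric])
        (auto intro!: m1.cong_on m2.add sec f g int[of "\<lambda>v. f v + g v"])
  qed (simp add: m1.one m2.one)
qed

text \<open>Haar measure is translation invariant: for fixed \<open>x\<close> the phase of
  \<open>g1 x\<close> is absorbed into the shift \<open>c\<close>, over which
  \<open>equidistributed\<close> quantifies for this reason.\<close>

lemma equidistributed_prod:
  assumes "mean X m1" "equidistributed I m2 g2"
  shows "equidistributed I (\<lambda>h. m1 (\<lambda>x. m2 (\<lambda>y. h (x, y)))) (\<lambda>(x, y) i. g1 x i + g2 y i)"
  using assms mean.const[OF assms(1), of 0]
  by (simp add: equidistributed_def phase_add add.commute[of "phase _ (g1 _)"] add.assoc)

section \<open>Fejer averages along a map to the torus\<close>

locale torus_mean = mean X m for X :: "'a set" and m +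
  fixes I :: "'i set" and w :: "'a \<Rightarrow> 'i \<Rightarrow> real"
  assumes equi: "equidistributed I m w"
begin

lemma mean_cos:
  assumes "n \<in> freqs I"
  shows "m (\<lambda>x. cos (phase n (w x) + c)) = (if n = (\<lambda>_. 0) then cos c else 0)"
  using equi assms by (auto simp: equidistributed_def const)

lemma mean_sin:
  assumes "n \<in> freqs I"
  shows "m (\<lambda>x. sin (phase n (w x))) = 0"
proof -
  have "sin y = cos (y + - pi / 2)" for y :: real by (simp add: cos_diff)
  then show ?thesis using mean_cos[OF assms, of "- pi / 2"] by simp
qed

text \<open>The Fejer mean at \<open>z\<close> of the conditional expectation of \<open>h\<close>
  given \<open>w\<close>, that is, of the Haar density of the image under \<open>w\<close> of the
  signed measure \<open>h dm\<close>. The density itself is never formed.\<close>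

definition avg :: "'i set \<times> nat \<Rightarrow> ('a \<Rightarrow> real) \<Rightarrow> ('i \<Rightarrow> real) \<Rightarrow> real" where
  "avg A h z = m (\<lambda>x. h x * fejer (fst A) (snd A) (\<lambda>i. z i - w x i))"

lemma bdd_on_fejer [intro]: "finite F \<Longrightarrow> bdd_on X (\<lambda>x. fejer F N (f x))"
  unfolding fejer_expand by (intro bdd_on_sum bdd_on_mult bdd_on_const bdd_on_cos)

lemma avg_add:
  assumes "finite (fst A)" "bdd_on X f" "bdd_on X g"
  shows "avg A (\<lambda>x. f x + g x) z = avg A f z + avg A g z"
  unfolding avg_def distrib_right using assms by (intro add) auto

lemma avg_diff:
  assumes "finite (fst A)" "bdd_on X f" "bdd_on X g"
  shows "avg A (\<lambda>x. f x - g x) z = avg A f z - avg A g z"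
  unfolding avg_def left_diff_distrib using assms by (intro diff) auto

lemma avg_scale:
  assumes "finite (fst A)" "bdd_on X f"
  shows "avg A (\<lambda>x. c * f x) z = c * avg A f z"
  unfolding avg_def mult.assoc using assms by (intro scale) auto

lemma avg_expand:
  assumes "finite F" "F \<subseteq> I" "bdd_on X h"
  shows "avg (F, N) h z = 
    (\<Sum>n\<in>grid_diffs F N. fejer_coeff F N n * m (\<lambda>x. h x * cos (phase n z - phase n (w x))))"
proof -
  have "avg (F, N) h z = 
    m (\<lambda>x. \<Sum>n\<in>grid_diffs F N. fejer_coeff F N n * (h x * cos (phase n z - phase n (w x))))"
    by (simp add: avg_def fejer_expand assms(1) phase_diff sum_distrib_left mult_ac)
  also have "\<dots> = (\<Sum>n\<in>grid_diffs F N. fejer_coeff F N n * m (\<lambda>x. h x * cos (phase n z - phase n (w x))))"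
    using assms(3) by (simp add: sum scale bdd_on_mult)
  finally show ?thesis .
qed

text \<open>Every frequency except 0 has mean zero, and the coefficient at 0 is 1: the kernel has
  total mass 1.\<close>

lemma avg_one:
  assumes "finite F" "F \<subseteq> I" "N > 0"
  shows "avg (F, N) (\<lambda>_. 1) z = 1"
proof -
  have "avg (F, N) (\<lambda>_. 1) z = (\<Sum>n\<in>grid_diffs F N. if n = (\<lambda>_. 0) then 1 else 0)"
    unfolding avg_expand[OF assms(1,2) bdd_on_const]
  proof (intro sum.cong refl)
    fix n assume "n \<in> grid_diffs F N"
    then have n: "n \<in> freqs I" using grid_diffs_subset assms by blast
    have "m (\<lambda>x. cos (phase n z - phase n (w x))) = (if n = (\<lambda>_. 0) then 1 else 0)"
      using mean_cos[OF n, of "- phase n z"] by (simp add: cos_diff cos_add mult.commute)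
    then show "fejer_coeff F N n * m (\<lambda>x. 1 * cos (phase n z - phase n (w x))) = (if n = (\<lambda>_. 0) then 1 else 0)"
      using fejer_coeff_zero assms by auto
  qed
  also have "\<dots> = 1" using zero_in_grid_diffs[OF assms(3)] finite_grid_diffs[OF assms(1)] by simp
  finally show ?thesis .
qed

text \<open>A nonnegative kernel of mass 1 yields a contraction for the supremum norm. This bound,
  uniform in \<open>F\<close>, \<open>N\<close> and \<open>z\<close>, carries all later passages to
  limits.\<close>

lemma abs_avg_le:
  assumes A: "finite F" "F \<subseteq> I" "N > 0" and h: "\<And>x. x \<in> X \<Longrightarrow> \<bar>h x\<bar> \<le> B"
  shows "\<bar>avg (F, N) h z\<bar> \<le> B"
proof -
  have "\<bar>avg (F, N) h z\<bar> \<le> m (\<lambda>x. B * fejer F N (\<lambda>i. z i - w x i))"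
    unfolding avg_def fst_conv snd_conv
    using A bdd_onI[of X h B, OF h] fejer_nonneg[OF A(1)] h
    by (intro abs_le) (auto simp: abs_mult intro!: mult_right_mono)
  also have "\<dots> = B"
    using avg_one[OF A] A by (simp add: avg_def scale bdd_on_fejer)
  finally show ?thesis .
qed

text \<open>Averaging multiplies each character by its Fejer coefficient. The cosine involves
  \<open>k\<close> and \<open>- k\<close>, hence the arithmetic mean of two coefficients, and both
  tend to 1.\<close>

lemma avg_cos_tendsto:
  assumes k: "k \<in> freqs I"
  shows "((\<lambda>A. avg A (\<lambda>x. cos (phase k (w x) + c)) z) \<longlongrightarrow> cos (phase k z + c)) (fejer_filter I)"
proof -
  let ?k = "\<lambda>i. - k i"
  have eq: "avg (F, N) (\<lambda>x. cos (phase k (w x) + c)) z =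
      (fejer_coeff F N k + fejer_coeff F N ?k) / 2 * cos (phase k z + c)"
    if A: "finite F" "F \<subseteq> I" "N > 0" for F N
  proof -
    \<comment> \<open>For \<open>k = 0\<close> the two conditions coincide and the halves add up. If
      \<open>k\<close> or \<open>- k\<close> is not in \<open>grid_diffs F N\<close>, its
      coefficient is 0, so the sum still has the claimed value.\<close>
    have "avg (F, N) (\<lambda>x. cos (phase k (w x) + c)) z = 
      (\<Sum>n\<in>grid_diffs F N. (if n = k then fejer_coeff F N k / 2 * cos (phase k z + c) else 0) + 
          (if n = ?k then fejer_coeff F N ?k / 2 * cos (phase k z + c) else 0))"
      unfolding avg_expand[OF A(1,2) bdd_on_cos]
    proof (intro sum.cong refl)
      fix n assume "n \<in> grid_diffs F N"
      then have n: "n \<in> freqs I" using grid_diffs_subset A by blast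
      have "cos (phase k (w x) + c) * cos (phase n z - phase n (w x)) 
        = 1/2 * (cos (phase (\<lambda>i. k i - n i) (w x) + (c + phase n z)) + 
                cos (phase (\<lambda>i. k i + n i) (w x) + (c - phase n z)))" for x
        by (simp add: cos_times_cos phase_freq_diff[OF k n] phase_freq_add[OF k n] algebra_simps)
      then have "m (\<lambda>x. cos (phase k (w x) + c) * cos (phase n z - phase n (w x))) 
        = m (\<lambda>x. 1/2 * (cos (phase (\<lambda>i. k i - n i) (w x) + (c + phase n z)) + 
                cos (phase (\<lambda>i. k i + n i) (w x) + (c - phase n z))))" by presburger
      also have "\<dots> = (if (\<lambda>i. k i - n i) = (\<lambda>_. 0) then cos (c + phase n z) / 2 else 0) +
          (if (\<lambda>i. k i + n i) = (\<lambda>_. 0) then cos (c - phase n z) / 2 else 0)"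
        by (subst scale) (auto simp: add mean_cos freqs_diff freqs_add k n)
      also have "\<dots> = (if n = k then cos (phase k z + c) / 2 else 0) + (if n = ?k then cos (phase k z + c) / 2 else 0)"
      proof -
        have "(\<lambda>i. k i - n i) = (\<lambda>_. 0) \<longleftrightarrow> n = k" "(\<lambda>i. k i + n i) = (\<lambda>_. 0) \<longleftrightarrow> n = ?k"
          by (auto simp: fun_eq_iff) (metis add_eq_0_iff minus_equation_iff)+
        then show ?thesis by (auto simp: add.commute phase_freq_minus)
      qed
      finally show "fejer_coeff F N n * m (\<lambda>x. cos (phase k (w x) + c) * cos (phase n z - phase n (w x))) =
        (if n = k then fejer_coeff F N k / 2 * cos (phase k z + c) else 0) + 
          (if n = ?k then fejer_coeff F N ?k / 2 * cos (phase k z + c) else 0)"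
        by (auto simp: distrib_left)
    qed
    also have "\<dots> = (fejer_coeff F N k + fejer_coeff F N ?k) / 2 * cos (phase k z + c)"
      using finite_grid_diffs[OF A(1)] fejer_coeff_eq_0[of k F N] fejer_coeff_eq_0[of ?k F N]
      by (auto simp: sum.distrib distrib_right add_divide_distrib)
    finally show ?thesis .
  qed
  have "((\<lambda>A. (fejer_coeff (fst A) (snd A) k + fejer_coeff (fst A) (snd A) ?k) / 2 * cos (phase k z + c))
     \<longlongrightarrow> (1 + 1) / 2 * cos (phase k z + c)) (fejer_filter I)"
    using fejer_coeff_tendsto[OF k] fejer_coeff_tendsto[OF freqs_minus[OF k]]
    by (intro tendsto_intros) (simp_all add: case_prod_unfold)
  moreover have "\<forall>\<^sub>F A in fejer_filter I. 
     (fejer_coeff (fst A) (snd A) k + fejer_coeff (fst A) (snd A) ?k) / 2 * cos (phase k z + c)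
     = avg A (\<lambda>x. cos (phase k (w x) + c)) z"
    by (rule eventually_mono[OF eventually_fejer_filter_finite]) (auto simp: eq)
  ultimately show ?thesis by (auto dest: Lim_transform_eventually)
qed

text \<open>Expand the mean of the squared modulus of \<open>u\<close> minus its Fourier sum over
  \<open>M\<close>, which is nonnegative. By orthogonality of the characters only the diagonal of
  the double sum \<open>?k\<close> survives, so the mixed term and the square of the sum both reduce
  to the sum of squared coefficients.\<close>

lemma bessel:
  assumes u: "bdd_on X u" and M: "finite M" "M \<subseteq> freqs I"
  shows "(\<Sum>n\<in>M. (m (\<lambda>x. u x * cos (phase n (w x))))\<^sup>2 + (m (\<lambda>x. u x * sin (phase n (w x))))\<^sup>2)
     \<le> m (\<lambda>x. (u x)\<^sup>2)"
proof -
  define a where "a n = m (\<lambda>x. u x * cos (phase n (w x)))" for n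
  define b where "b n = m (\<lambda>x. u x * sin (phase n (w x)))" for n
  define C where "C n x = cos (phase n (w x))" for n x
  define D where "D n x = sin (phase n (w x))" for n x
  note [intro] = u
  have CD [intro]: "bdd_on X (C n)" "bdd_on X (D n)" for n unfolding C_def D_def by auto
  \<comment> \<open>\<open>?s\<close> and \<open>?t\<close> are the real and imaginary part of the Fourier sum \<open>\<Sum>n\<in>M. c n * cis (- phase n (w x))\<close>,
    where \<open>c n\<close> has real part \<open>a n\<close> and imaginary part \<open>b n\<close>.\<close>
  let ?s = "\<lambda>x. \<Sum>n\<in>M. a n * C n x + b n * D n x"
  let ?t = "\<lambda>x. \<Sum>n\<in>M. b n * C n x - a n * D n x"
  let ?k = "\<lambda>x. \<Sum>n\<in>M. \<Sum>k\<in>M. (a n * a k + b n * b k) * cos (phase (\<lambda>i. n i - k i) (w x))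
               + (b n * a k - a n * b k) * sin (phase (\<lambda>i. n i - k i) (w x))"
  have k: "(?s x)\<^sup>2 + (?t x)\<^sup>2 = ?k x" for x
  proof -
    have "(?s x)\<^sup>2 + (?t x)\<^sup>2 = (\<Sum>n\<in>M. \<Sum>k\<in>M. (a n * C n x + b n * D n x) * (a k * C k x + b k * D k x)
       + (b n * C n x - a n * D n x) * (b k * C k x - a k * D k x))"
      by (simp only: power2_eq_square sum_product flip: sum.distrib)
    also have "\<dots> = ?k x"
    proof (intro sum.cong refl)
      fix n k assume "n \<in> M" "k \<in> M"
      then have "n \<in> freqs I" "k \<in> freqs I" using M by auto
      then show "(a n * C n x + b n * D n x) * (a k * C k x + b k * D k x)
       + (b n * C n x - a n * D n x) * (b k * C k x - a k * D k x) = 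
       (a n * a k + b n * b k) * cos (phase (\<lambda>i. n i - k i) (w x))
               + (b n * a k - a n * b k) * sin (phase (\<lambda>i. n i - k i) (w x))"
        by (simp add: phase_freq_diff[of _ I] cos_diff sin_diff C_def D_def algebra_simps)
    qed
    finally show ?thesis .
  qed
  have "m ?k = (\<Sum>n\<in>M. \<Sum>k\<in>M. (a n * a k + b n * b k) * m (\<lambda>x. cos (phase (\<lambda>i. n i - k i) (w x)))
               + (b n * a k - a n * b k) * m (\<lambda>x. sin (phase (\<lambda>i. n i - k i) (w x))))"
    by (simp add: sum add scale bdd_on_sum bdd_on_add bdd_on_mult)
  also have "\<dots> = (\<Sum>n\<in>M. \<Sum>k\<in>M. if k = n then (a n)\<^sup>2 + (b n)\<^sup>2 else 0)"
  proof (intro sum.cong refl)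
    fix n k assume "n \<in> M" "k \<in> M"
    then have nk: "(\<lambda>i. n i - k i) \<in> freqs I" using M by (auto intro!: freqs_diff)
    have "(\<lambda>i. n i - k i) = (\<lambda>_. 0) \<longleftrightarrow> k = n" by (auto simp: fun_eq_iff)
    then show "(a n * a k + b n * b k) * m (\<lambda>x. cos (phase (\<lambda>i. n i - k i) (w x)))
               + (b n * a k - a n * b k) * m (\<lambda>x. sin (phase (\<lambda>i. n i - k i) (w x)))
        = (if k = n then (a n)\<^sup>2 + (b n)\<^sup>2 else 0)"
      using mean_cos[OF nk, of 0] mean_sin[OF nk] by (auto simp: power2_eq_square)
  qed
  also have "\<dots> = (\<Sum>n\<in>M. (a n)\<^sup>2 + (b n)\<^sup>2)" using M by simp
  finally have mk: "m ?k = (\<Sum>n\<in>M. (a n)\<^sup>2 + (b n)\<^sup>2)" .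
  have "m (\<lambda>x. u x * ?s x) = m (\<lambda>x. \<Sum>n\<in>M. a n * (u x * C n x) + b n * (u x * D n x))"
    by (simp add: sum_distrib_left distrib_left mult_ac)
  also have "\<dots> = (\<Sum>n\<in>M. a n * m (\<lambda>x. u x * C n x) + b n * m (\<lambda>x. u x * D n x))"
    by (simp add: sum add scale bdd_on_mult bdd_on_add u CD)
  also have "\<dots> = (\<Sum>n\<in>M. (a n)\<^sup>2 + (b n)\<^sup>2)"
    by (simp add: a_def b_def C_def D_def power2_eq_square)
  finally have ms: "m (\<lambda>x. u x * ?s x) = (\<Sum>n\<in>M. (a n)\<^sup>2 + (b n)\<^sup>2)" .
  have "0 \<le> m (\<lambda>x. (u x - ?s x)\<^sup>2 + (?t x)\<^sup>2)"
    by (intro nonneg bdd_on_intros u CD) auto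
  also have "\<dots> = m (\<lambda>x. ((u x)\<^sup>2 - 2 * (u x * ?s x)) + ((?s x)\<^sup>2 + (?t x)\<^sup>2))"
    by (simp add: power2_eq_square algebra_simps)
  also have "\<dots> = m (\<lambda>x. ((u x)\<^sup>2 - 2 * (u x * ?s x)) + ?k x)"
    unfolding k ..
  also have "\<dots> = m (\<lambda>x. (u x)\<^sup>2 - 2 * (u x * ?s x)) + m ?k"
    by (rule add) (intro bdd_on_intros u CD)+
  also have "m (\<lambda>x. (u x)\<^sup>2 - 2 * (u x * ?s x)) = m (\<lambda>x. (u x)\<^sup>2) - m (\<lambda>x. 2 * (u x * ?s x))"
    by (rule diff) (intro bdd_on_intros u CD)+
  also have "m (\<lambda>x. 2 * (u x * ?s x)) = 2 * m (\<lambda>x. u x * ?s x)"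
    by (rule scale) (intro bdd_on_intros u CD)+
  finally show ?thesis using mk ms by (simp add: a_def b_def)
qed

end

section \<open>Functions whose Fejer means converge uniformly\<close>

context torus_mean
begin

text \<open>The Fourier series of the density is dominated by \<open>b\<close> uniformly in
  \<open>z\<close>. Its Fejer means weight the terms by coefficients in \<open>[0,1]\<close> that
  tend to 1, so they converge uniformly to its sum \<open>l\<close>.\<close>

lemma avg_uniform_limit_of_summable:
  assumes h: "bdd_on X h" and b: "b summable_on freqs I"
    and le: "\<And>n z. n \<in> freqs I \<Longrightarrow> \<bar>m (\<lambda>x. h x * cos (phase n z - phase n (w x)))\<bar> \<le> b n"
  shows "\<exists>l. uniform_limit UNIV (\<lambda>A. avg A h) l (fejer_filter I)"
proof -
  define c where "c n z = m (\<lambda>x. h x * cos (phase n z - phase n (w x)))" for n z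
  define l where "l z = infsum (\<lambda>n. c n z) (freqs I)" for z
  have le: "\<bar>c n z\<bar> \<le> b n" if "n \<in> freqs I" for n z using le[OF that] by (simp add: c_def)
  have b0: "0 \<le> b n" if "n \<in> freqs I" for n using le[OF that] abs_ge_zero order_trans by blast
  have csum: "(\<lambda>n. c n z) summable_on freqs I" for z
    by (rule abs_summable_summable, rule summable_on_comparison_test[OF b]) (use le in auto)
  have "uniform_limit UNIV (\<lambda>A. avg A h) l (fejer_filter I)"
  proof (rule uniform_limitI)
    fix e :: real assume e: "e > 0"
    \<comment> \<open>Accuracy \<open>e / 8\<close> makes \<open>b\<close> sum to at most
      \<open>e / 4\<close> over any finite set of frequencies off \<open>M\<close>. This tail is
      paid once for \<open>l\<close> and once for the Fejer mean; the deficit of the coefficients on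
      \<open>M\<close> costs less than a further \<open>e / 4\<close>.\<close>
    have "\<forall>\<^sub>F M in finite_subsets_at_top (freqs I). dist (sum b M) (infsum b (freqs I)) < e / 8"
      using e by (intro tendstoD[OF infsum_tendsto[OF b]]) simp
    then obtain M where M: "finite M" "M \<subseteq> freqs I" and
      M': "\<forall>M'. finite M' \<and> M \<subseteq> M' \<and> M' \<subseteq> freqs I \<longrightarrow> dist (sum b M') (infsum b (freqs I)) < e / 8"
      unfolding eventually_finite_subsets_at_top by (elim exE conjE)
    have tail: "sum b (G - M) \<le> e / 4" if "finite G" "G \<subseteq> freqs I" for G
    proof -
      have "sum b (G \<union> M) = sum b (G - M) + sum b M"
        using sum.union_disjoint[of "G - M" M b] that M by (simp add: Un_Diff_cancel2 Diff_Int_distrib2)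
      moreover have "dist (sum b (G \<union> M)) (infsum b (freqs I)) < e / 8" "dist (sum b M) (infsum b (freqs I)) < e / 8"
        using M' that M by auto
      ultimately show ?thesis unfolding dist_real_def by linarith
    qed
    have l: "\<bar>l z - (\<Sum>n\<in>M. c n z)\<bar> \<le> e / 4" for z
    proof -
      have "((\<lambda>G. \<bar>(\<Sum>n\<in>G. c n z) - (\<Sum>n\<in>M. c n z)\<bar>) \<longlongrightarrow> \<bar>l z - (\<Sum>n\<in>M. c n z)\<bar>) (finite_subsets_at_top (freqs I))"
        unfolding l_def by (intro tendsto_intros infsum_tendsto csum)
      moreover have "\<forall>\<^sub>F G in finite_subsets_at_top (freqs I). \<bar>(\<Sum>n\<in>G. c n z) - (\<Sum>n\<in>M. c n z)\<bar> \<le> e / 4"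
        unfolding eventually_finite_subsets_at_top
      proof (intro exI[of _ M] conjI allI impI M)
        fix G assume G: "finite G \<and> M \<subseteq> G \<and> G \<subseteq> freqs I"
        then have "\<bar>(\<Sum>n\<in>G. c n z) - (\<Sum>n\<in>M. c n z)\<bar> = \<bar>\<Sum>n\<in>G - M. c n z\<bar>"
          by (simp add: sum_diff)
        also have "\<dots> \<le> sum b (G - M)" using G le by (intro order_trans[OF sum_abs] sum_mono) auto
        also have "\<dots> \<le> e / 4" using tail G by auto
        finally show "\<bar>(\<Sum>n\<in>G. c n z) - (\<Sum>n\<in>M. c n z)\<bar> \<le> e / 4" .
      qed
      ultimately show ?thesis by (intro tendsto_upperbound) auto
    qed
    have "((\<lambda>A. \<Sum>n\<in>M. (1 - (case A of (F, N) \<Rightarrow> fejer_coeff F N n)) * b n) \<longlongrightarrow> (\<Sum>n\<in>M. (1 - 1) * b n)) (fejer_filter I)"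
      using M by (intro tendsto_intros fejer_coeff_tendsto) auto
    then have "\<forall>\<^sub>F A in fejer_filter I. (\<Sum>n\<in>M. (1 - (case A of (F, N) \<Rightarrow> fejer_coeff F N n)) * b n) < e / 4"
      using e by (intro order_tendstoD(2)) auto
    then show "\<forall>\<^sub>F A in fejer_filter I. \<forall>z\<in>UNIV. dist (avg A h z) (l z) < e"
      using eventually_fejer_filter_finite
    proof eventually_elim
      case (elim A)
      obtain F N where A: "A = (F, N)" by force
      with elim have F: "finite F" "F \<subseteq> I" and
        small: "(\<Sum>n\<in>M. (1 - fejer_coeff F N n) * b n) < e / 4" by auto
      let ?D = "grid_diffs F N" and ?k = "fejer_coeff F N"
      have D: "finite ?D" "?D \<subseteq> freqs I" by (simp_all add: finite_grid_diffs grid_diffs_subset F)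
      show ?case
      proof
        fix z
        have "avg A h z = (\<Sum>n\<in>?D. ?k n * c n z)" using avg_expand[OF F h] by (simp add: A c_def)
        also have "\<dots> = (\<Sum>n\<in>?D \<union> M. ?k n * c n z)"
          using D M fejer_coeff_eq_0 by (intro sum.mono_neutral_left) auto
        also have "\<dots> = (\<Sum>n\<in>?D - M. ?k n * c n z) + (\<Sum>n\<in>M. ?k n * c n z)"
          using sum.union_disjoint[of "?D - M" M "\<lambda>n. ?k n * c n z"] D M by (simp add: Un_Diff_cancel2 Diff_Int_distrib2)
        finally have "avg A h z - (\<Sum>n\<in>M. c n z) = (\<Sum>n\<in>?D - M. ?k n * c n z) - (\<Sum>n\<in>M. (1 - ?k n) * c n z)"
          by (simp add: left_diff_distrib sum_subtractf)
        moreover have "\<bar>\<Sum>n\<in>?D - M. ?k n * c n z\<bar> \<le> sum b (?D - M)"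
        proof (rule order_trans[OF sum_abs sum_mono])
          fix n assume "n \<in> ?D - M"
          then have n: "n \<in> freqs I" using D by auto
          have "\<bar>?k n * c n z\<bar> \<le> 1 * b n" unfolding abs_mult
            using fejer_coeff_nonneg[of F N n] fejer_coeff_le_1[OF F(1), of N n] le[OF n] by (intro mult_mono) auto
          then show "\<bar>?k n * c n z\<bar> \<le> b n" by simp
        qed
        moreover have "sum b (?D - M) \<le> e / 4" using tail D by auto
        moreover have "\<bar>\<Sum>n\<in>M. (1 - ?k n) * c n z\<bar> \<le> (\<Sum>n\<in>M. (1 - ?k n) * b n)"
        proof (rule order_trans[OF sum_abs sum_mono])
          fix n assume "n \<in> M"
          then show "\<bar>(1 - ?k n) * c n z\<bar> \<le> (1 - ?k n) * b n" 
            using fejer_coeff_le_1[OF F(1), of N n] le[of n] M by (auto simp: abs_mult intro!: mult_left_mono)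
        qed
        ultimately show "dist (avg A h z) (l z) < e"
          using small l[of z] e unfolding dist_real_def by linarith
      qed
    qed
  qed
  then show ?thesis by blast
qed

definition avg_converges :: "('a \<Rightarrow> real) \<Rightarrow> bool" where
  "avg_converges h \<longleftrightarrow> bdd_on X h \<and> (\<exists>l. uniform_limit UNIV (\<lambda>A. avg A h) l (fejer_filter I))"

text \<open>A continuous version of the conditional expectation of \<open>h\<close> given
  \<open>w\<close>, meaningful when \<open>avg_converges h\<close> holds.\<close>

definition lim_avg :: "('a \<Rightarrow> real) \<Rightarrow> ('i \<Rightarrow> real) \<Rightarrow> real" where
  "lim_avg h z = Lim (fejer_filter I) (\<lambda>A. avg A h z)"

lemma lim_avg_eqI: "((\<lambda>A. avg A h z) \<longlongrightarrow> y) (fejer_filter I) \<Longrightarrow> lim_avg h z = y"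
  unfolding lim_avg_def by (rule tendsto_Lim) (simp add: fejer_filter_neq_bot)

lemma uniform_limit_lim_avg:
  assumes "avg_converges h"
  shows "uniform_limit UNIV (\<lambda>A. avg A h) (lim_avg h) (fejer_filter I)"
proof -
  from assms obtain l where l: "uniform_limit UNIV (\<lambda>A. avg A h) l (fejer_filter I)"
    by (auto simp: avg_converges_def)
  have "lim_avg h z = l z" for z by (rule lim_avg_eqI) (rule tendsto_uniform_limitI[OF l UNIV_I])
  then have "lim_avg h = l" by auto
  with l show ?thesis by simp
qed

lemma tendsto_lim_avg: "avg_converges h \<Longrightarrow> ((\<lambda>A. avg A h z) \<longlongrightarrow> lim_avg h z) (fejer_filter I)"
  by (rule tendsto_uniform_limitI[OF uniform_limit_lim_avg]) auto

lemma eventually_finite_fst: "\<forall>\<^sub>F A in fejer_filter I. finite (fst A)"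
  by (rule eventually_mono[OF eventually_fejer_filter_finite]) auto

lemma avg_converges_add:
  assumes "avg_converges f" "avg_converges g"
  shows "avg_converges (\<lambda>x. f x + g x)"
    and "lim_avg (\<lambda>x. f x + g x) z = lim_avg f z + lim_avg g z"
proof -
  have b: "bdd_on X f" "bdd_on X g" using assms by (auto simp: avg_converges_def)
  have "uniform_limit UNIV (\<lambda>A z. avg A f z + avg A g z) (\<lambda>z. lim_avg f z + lim_avg g z) (fejer_filter I)"
    by (intro uniform_limit_add uniform_limit_lim_avg assms)
  also have "?this \<longleftrightarrow> uniform_limit UNIV (\<lambda>A. avg A (\<lambda>x. f x + g x)) (\<lambda>z. lim_avg f z + lim_avg g z) (fejer_filter I)"
    by (intro uniform_limit_cong eventually_mono[OF eventually_finite_fst]) (auto simp: avg_add b)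
  finally have *: \<dots> .
  then show "avg_converges (\<lambda>x. f x + g x)" using b by (auto simp: avg_converges_def)
  show "lim_avg (\<lambda>x. f x + g x) z = lim_avg f z + lim_avg g z"
    by (rule lim_avg_eqI) (rule tendsto_uniform_limitI[OF * UNIV_I])
qed

lemma lim_avg_scale:
  assumes "avg_converges f"
  shows "lim_avg (\<lambda>x. c * f x) z = c * lim_avg f z"
proof (rule lim_avg_eqI, rule Lim_transform_eventually)
  show "((\<lambda>A. c * avg A f z) \<longlongrightarrow> c * lim_avg f z) (fejer_filter I)"
    by (intro tendsto_intros tendsto_lim_avg assms)
  show "\<forall>\<^sub>F A in fejer_filter I. c * avg A f z = avg A (\<lambda>x. c * f x) z"
    by (rule eventually_mono[OF eventually_finite_fst]) (use assms in \<open>auto simp: avg_scale avg_converges_def\<close>)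
qed

lemma avg_converges_zero: "avg_converges (\<lambda>_. 0)"
proof -
  have "avg A (\<lambda>_. 0) z = 0" for A z by (simp add: avg_def const)
  then have "uniform_limit UNIV (\<lambda>A. avg A (\<lambda>_. 0)) (\<lambda>_. 0) (fejer_filter I)"
    by (intro uniform_limitI) auto
  then show ?thesis by (auto simp: avg_converges_def)
qed

lemma avg_converges_sum:
  "(\<And>j. j \<in> J \<Longrightarrow> avg_converges (f j)) \<Longrightarrow> avg_converges (\<lambda>x. \<Sum>j\<in>J. f j x)"
  by (induction J rule: infinite_finite_induct) (auto simp: avg_converges_zero avg_converges_add)

lemma eventually_avg_close:
  assumes "bdd_on X f" "bdd_on X g" "\<And>x. x \<in> X \<Longrightarrow> \<bar>f x - g x\<bar> \<le> e"
  shows "\<forall>\<^sub>F A in fejer_filter I. \<forall>z. \<bar>avg A f z - avg A g z\<bar> \<le> e"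
  using eventually_fejer_filter_finite
proof eventually_elim
  case (elim A)
  obtain F N where A: "A = (F, N)" by force
  show ?case
  proof
    fix z
    show "\<bar>avg A f z - avg A g z\<bar> \<le> e"
      using abs_avg_le[of F N "\<lambda>x. f x - g x" e z] elim assms avg_diff[of A f g z] by (simp add: A)
  qed
qed

lemma abs_lim_avg_le:
  assumes "avg_converges h" "\<And>x. x \<in> X \<Longrightarrow> \<bar>h x\<bar> \<le> B"
  shows "\<bar>lim_avg h z\<bar> \<le> B"
proof (rule tendsto_upperbound)
  show "((\<lambda>A. \<bar>avg A h z\<bar>) \<longlongrightarrow> \<bar>lim_avg h z\<bar>) (fejer_filter I)"
    by (intro tendsto_intros tendsto_lim_avg assms)
  show "\<forall>\<^sub>F A in fejer_filter I. \<bar>avg A h z\<bar> \<le> B"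
    by (rule eventually_mono[OF eventually_fejer_filter_finite]) (use abs_avg_le assms(2) in auto)
qed (simp add: fejer_filter_neq_bot)

text \<open>Since averaging is a contraction, the limits \<open>lim_avg (f k)\<close> of uniform
  approximants are uniformly Cauchy; a three-term estimate then identifies their limit with that of
  the averages of \<open>h\<close>.\<close>

lemma avg_converges_closure:
  assumes h: "bdd_on X h"
    and approx: "\<And>e. e > 0 \<Longrightarrow> \<exists>f. avg_converges f \<and> (\<forall>x\<in>X. \<bar>h x - f x\<bar> \<le> e)"
  shows "avg_converges h"
proof -
  have "\<forall>k. \<exists>f. avg_converges f \<and> (\<forall>x\<in>X. \<bar>h x - f x\<bar> \<le> 1 / Suc k)"
    using approx by simp
  then obtain f where f: "\<And>k. avg_converges (f k)" "\<And>k x. x \<in> X \<Longrightarrow> \<bar>h x - f k x\<bar> \<le> 1 / Suc k"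
    by metis
  have fb: "bdd_on X (f k)" for k using f by (auto simp: avg_converges_def)
  have close: "\<forall>\<^sub>F A in fejer_filter I. \<forall>z. \<bar>avg A h z - avg A (f k) z\<bar> \<le> 1 / Suc k" for k
    by (rule eventually_avg_close[OF h fb f(2)])
  have lim_close: "\<bar>lim_avg (f k) z - lim_avg (f j) z\<bar> \<le> 1 / Suc k + 1 / Suc j" for j k z
  proof (rule tendsto_upperbound)
    show "((\<lambda>A. \<bar>avg A (f k) z - avg A (f j) z\<bar>) \<longlongrightarrow> \<bar>lim_avg (f k) z - lim_avg (f j) z\<bar>) (fejer_filter I)"
      by (intro tendsto_intros tendsto_lim_avg f)
    show "\<forall>\<^sub>F A in fejer_filter I. \<bar>avg A (f k) z - avg A (f j) z\<bar> \<le> 1 / Suc k + 1 / Suc j"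
      using close[of k] close[of j]
    proof eventually_elim
      case (elim A)
      from elim(1)[rule_format, of z] elim(2)[rule_format, of z] show ?case by linarith
    qed
  qed (simp add: fejer_filter_neq_bot)
  have inv: "\<exists>K. \<forall>k\<ge>K. 1 / real (Suc k) < e" if "e > 0" for e :: real
  proof -
    obtain K where K: "1 / real (Suc K) < e" using reals_Archimedean[OF \<open>e > 0\<close>] by (auto simp: inverse_eq_divide)
    have "1 / real (Suc k) \<le> 1 / real (Suc K)" if "k \<ge> K" for k
      using that by (intro divide_left_mono) auto
    with K show ?thesis by (meson le_less_trans)
  qed
  have "uniformly_Cauchy_on UNIV (\<lambda>k. lim_avg (f k))"
  proof (rule uniformly_Cauchy_onI)
    fix e :: real assume "e > 0"
    then obtain K where K: "\<And>k. k \<ge> K \<Longrightarrow> 1 / real (Suc k) < e / 2" using inv[of "e / 2"] by auto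
    show "\<exists>M. \<forall>x\<in>UNIV. \<forall>i\<ge>M. \<forall>j\<ge>M. dist (lim_avg (f i) x) (lim_avg (f j) x) < e"
    proof (intro exI[of _ K] ballI allI impI)
      fix z i j assume "K \<le> i" "K \<le> j"
      then show "dist (lim_avg (f i) z) (lim_avg (f j) z) < e"
        using K[of i] K[of j] lim_close[of i z j] unfolding dist_real_def by linarith
    qed
  qed
  then obtain l where l: "uniform_limit UNIV (\<lambda>k. lim_avg (f k)) l sequentially"
    using Cauchy_uniformly_convergent unfolding uniformly_convergent_on_def by blast
  have "uniform_limit UNIV (\<lambda>A. avg A h) l (fejer_filter I)"
  proof (rule uniform_limitI)
    fix e :: real assume e: "e > 0"
    then obtain K where K: "\<And>k. k \<ge> K \<Longrightarrow> 1 / real (Suc k) < e / 3" using inv[of "e / 3"] by auto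
    have "\<forall>\<^sub>F k in sequentially. k \<ge> K \<and> (\<forall>z\<in>UNIV. dist (lim_avg (f k) z) (l z) < e / 3)"
      using e by (intro eventually_conj eventually_ge_at_top uniform_limitD[OF l]) auto
    then obtain k where k: "k \<ge> K" "\<And>z. dist (lim_avg (f k) z) (l z) < e / 3"
      by (auto dest!: eventually_happens)
    have "\<forall>\<^sub>F A in fejer_filter I. \<forall>z\<in>UNIV. dist (avg A (f k) z) (lim_avg (f k) z) < e / 3"
      using e by (intro uniform_limitD[OF uniform_limit_lim_avg[OF f(1)]]) auto
    with close[of k] show "\<forall>\<^sub>F A in fejer_filter I. \<forall>z\<in>UNIV. dist (avg A h z) (l z) < e"
    proof eventually_elim
      case (elim A)
      show ?case
      proof
        fix z
        from elim(1)[rule_format, of z] elim(2)[rule_format, OF UNIV_I, of z] k(2)[of z] K[OF k(1)]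
        show "dist (avg A h z) (l z) < e" unfolding dist_real_def by linarith
      qed
    qed
  qed
  then show ?thesis using h by (auto simp: avg_converges_def)
qed

end

section \<open>Tensors of bounded functions on the two factors\<close>

lemma summable_fourier_squares:
  assumes "torus_mean X m I w" "bdd_on X u"
  shows "(\<lambda>n. (m (\<lambda>x. u x * cos (phase n (w x))))\<^sup>2 + (m (\<lambda>x. u x * sin (phase n (w x))))\<^sup>2) summable_on freqs I"
  using torus_mean.bessel[OF assms] by (intro nonneg_bdd_above_summable_on) (auto simp: bdd_above_def)

lemma torus_mean_prod:
  assumes "torus_mean X m1 I g1" "torus_mean Y m2 I g2"
  shows "torus_mean (X \<times> Y) (\<lambda>h. m1 (\<lambda>x. m2 (\<lambda>y. h (x, y)))) I (\<lambda>(x, y) i. g1 x i + g2 y i)"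
  using assms unfolding torus_mean_def torus_mean_axioms_def
  by (auto intro: mean_prod equidistributed_prod)

text \<open>The phase is additive along \<open>w\<close>, so each Fourier term of the tensor is a
  combination of products of a coefficient of \<open>u\<close> and one of \<open>v\<close>. Such
  products are dominated by sums of squares, which Bessel makes summable.\<close>

lemma avg_converges_rank_one:
  assumes 1: "torus_mean X m1 I g1" and 2: "torus_mean Y m2 I g2"
    and u: "bdd_on X u" and v: "bdd_on Y v"
  shows "torus_mean.avg_converges (X \<times> Y) (\<lambda>h. m1 (\<lambda>x. m2 (\<lambda>y. h (x, y)))) I 
    (\<lambda>(x, y) i. g1 x i + g2 y i) (\<lambda>(x, y). u x * v y)"
proof -
  interpret m1: torus_mean X m1 I g1 by fact
  interpret m2: torus_mean Y m2 I g2 by fact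
  define m where "m = (\<lambda>h. m1 (\<lambda>x. m2 (\<lambda>y. h (x, y))))"
  define w where "w = (\<lambda>(x, y) i. g1 x i + g2 y i)"
  interpret torus_mean "X \<times> Y" m I w
    unfolding m_def w_def by (rule torus_mean_prod[OF 1 2])
  define a where "a n = m1 (\<lambda>x. u x * cos (phase n (g1 x)))" for n
  define b where "b n = m1 (\<lambda>x. u x * sin (phase n (g1 x)))" for n
  define a' where "a' n = m2 (\<lambda>y. v y * cos (phase n (g2 y)))" for n
  define b' where "b' n = m2 (\<lambda>y. v y * sin (phase n (g2 y)))" for n
  have bdd: "bdd_on (X \<times> Y) (\<lambda>(x, y). u x * v y)"
  proof -
    have "bdd_on (X \<times> Y) (\<lambda>z. u (fst z))" "bdd_on (X \<times> Y) (\<lambda>z. v (snd z))"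
      using u v by (auto simp: bdd_on_def)
    then show ?thesis by (auto simp: case_prod_unfold)
  qed
  have "\<bar>m (\<lambda>z. (case z of (x, y) \<Rightarrow> u x * v y) * cos (phase n z' - phase n (w z)))\<bar> \<le>
      ((a n)\<^sup>2 + (b n)\<^sup>2) + ((a' n)\<^sup>2 + (b' n)\<^sup>2)" for n z'
  proof -
    define t where "t = phase n z'"
    have inner: "m2 (\<lambda>y. u x * v y * cos (t - (phase n (g1 x) + phase n (g2 y)))) =
       (cos t * a' n + sin t * b' n) * (u x * cos (phase n (g1 x))) + 
       (sin t * a' n - cos t * b' n) * (u x * sin (phase n (g1 x)))" for x
    proof -
      let ?P = "u x * cos (t - phase n (g1 x))" and ?Q = "u x * sin (t - phase n (g1 x))"
      have "u x * v y * cos (t - (phase n (g1 x) + phase n (g2 y))) =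
        ?P * (v y * cos (phase n (g2 y))) + ?Q * (v y * sin (phase n (g2 y)))" for y
        using cos_diff[of "t - phase n (g1 x)" "phase n (g2 y)"] by (simp add: diff_diff_eq distrib_left)
      then have "m2 (\<lambda>y. u x * v y * cos (t - (phase n (g1 x) + phase n (g2 y)))) =
        m2 (\<lambda>y. ?P * (v y * cos (phase n (g2 y))) + ?Q * (v y * sin (phase n (g2 y))))"
        by presburger
      also have "\<dots> = ?P * a' n + ?Q * b' n"
        unfolding a'_def b'_def using v
        by (simp add: m2.add m2.scale bdd_on_intros)
      finally show ?thesis by (simp add: cos_diff sin_diff algebra_simps)
    qed
    have "m (\<lambda>z. (case z of (x, y) \<Rightarrow> u x * v y) * cos (phase n z' - phase n (w z))) =
      m1 (\<lambda>x. m2 (\<lambda>y. u x * v y * cos (t - (phase n (g1 x) + phase n (g2 y)))))"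
      by (simp add: m_def w_def t_def phase_add)
    also have "\<dots> = (cos t * a' n + sin t * b' n) * a n + (sin t * a' n - cos t * b' n) * b n"
      unfolding inner a_def b_def using u
      by (simp add: m1.add m1.scale bdd_on_intros)
    also have "\<bar>\<dots>\<bar> \<le> ((a n)\<^sup>2 + (b n)\<^sup>2) + ((a' n)\<^sup>2 + (b' n)\<^sup>2)"
    proof -
      \<comment> \<open>Each of the four products costs half of two squares, and each square occurs
        twice: this gives the bound without further constant.\<close>
      have tm: "\<bar>r * p * q\<bar> \<le> (p\<^sup>2 + q\<^sup>2) / 2" if "\<bar>r\<bar> \<le> 1" for p q r :: real
      proof -
        have "\<bar>r * p * q\<bar> \<le> 1 * \<bar>p * q\<bar>" unfolding mult.assoc abs_mult[of r] 
          using that by (intro mult_right_mono) auto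
        also have "\<dots> \<le> (p\<^sup>2 + q\<^sup>2) / 2"
          using sum_squares_bound[of "\<bar>p\<bar>" "\<bar>q\<bar>"] by (simp add: abs_mult)
        finally show ?thesis .
      qed
      have "(cos t * a' n + sin t * b' n) * a n + (sin t * a' n - cos t * b' n) * b n =
        cos t * a' n * a n + sin t * b' n * a n + sin t * a' n * b n - cos t * b' n * b n"
        by (simp add: algebra_simps)
      then show ?thesis
        using tm[of "cos t" "a' n" "a n"] tm[of "sin t" "b' n" "a n"] tm[of "sin t" "a' n" "b n"] 
          tm[of "cos t" "b' n" "b n"] by simp
    qed
    finally show ?thesis .
  qed
  moreover have "(\<lambda>n. ((a n)\<^sup>2 + (b n)\<^sup>2) + ((a' n)\<^sup>2 + (b' n)\<^sup>2)) summable_on freqs I"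
    unfolding a_def b_def a'_def b'_def
    by (rule summable_on_add[OF summable_fourier_squares[OF 1 u] summable_fourier_squares[OF 2 v]])
  ultimately have "avg_converges (\<lambda>(x, y). u x * v y)"
    unfolding avg_converges_def using avg_uniform_limit_of_summable[OF bdd] bdd by blast
  then show ?thesis by (simp add: m_def w_def)
qed

section \<open>Continuous functions on the product\<close>

text \<open>By the tube lemma, which uses compactness of \<open>K2\<close>, nearby points of
  \<open>K1\<close> have uniformly close slices. A finite subcover leaves finitely many centres
  \<open>J\<close>, and \<open>r\<close> is an arbitrary choice of a centre for each point.\<close>

lemma compact_slices_approx:
  assumes K1: "compact_space K1" and K2: "compact_space K2"
    and h: "continuous_map (prod_topology K1 K2) euclideanreal h" and e: "e > 0"
  obtains J r where "finite J" "J \<subseteq> topspace K1" "\<And>x. x \<in> topspace K1 \<Longrightarrow> r x \<in> J"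
    "\<And>x y. x \<in> topspace K1 \<Longrightarrow> y \<in> topspace K2 \<Longrightarrow> \<bar>h (x, y) - h (r x, y)\<bar> < e"
proof -
  have "\<exists>U. openin K1 U \<and> x \<in> U \<and> (\<forall>x'\<in>U. \<forall>y\<in>topspace K2. \<bar>h (x', y) - h (x, y)\<bar> < e)"
    if x: "x \<in> topspace K1" for x
  proof -
    let ?W = "{v \<in> topspace (prod_topology K1 K2). \<bar>h v - h (x, snd v)\<bar> \<in> {..<e}}"
    have "continuous_map (prod_topology K1 K2) euclideanreal (\<lambda>v. h (x, snd v))"
      by (rule continuous_map_compose[OF _ h, unfolded o_def])
        (use x in \<open>auto intro!: continuous_map_pairedI continuous_map_snd\<close>)
    then have "continuous_map (prod_topology K1 K2) euclideanreal (\<lambda>v. \<bar>h v - h (x, snd v)\<bar>)"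
      by (intro continuous_map_real_abs continuous_map_diff h)
    then have W: "openin (prod_topology K1 K2) ?W"
      by (rule openin_continuous_map_preimage) simp
    have "\<exists>U V. openin K1 U \<and> openin K2 V \<and> x \<in> U \<and> topspace K2 \<subseteq> V \<and> U \<times> V \<subseteq> ?W"
      using K2 x e by (intro tube_lemma_right[OF W]) (auto simp: compact_space_def)
    then obtain U V where UV: "openin K1 U" "x \<in> U" "topspace K2 \<subseteq> V" "U \<times> V \<subseteq> ?W" by blast
    have "\<bar>h (x', y) - h (x, y)\<bar> < e" if "x' \<in> U" "y \<in> topspace K2" for x' y
    proof -
      have "(x', y) \<in> ?W" using UV that by blast
      then show ?thesis by simp
    qed
    then show ?thesis using UV by blast
  qed
  then obtain U where U: "\<And>x. x \<in> topspace K1 \<Longrightarrow> openin K1 (U x)" "\<And>x. x \<in> topspace K1 \<Longrightarrow> x \<in> U x"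
    "\<And>x x' y. x \<in> topspace K1 \<Longrightarrow> x' \<in> U x \<Longrightarrow> y \<in> topspace K2 \<Longrightarrow> \<bar>h (x', y) - h (x, y)\<bar> < e"
    by metis
  have "\<exists>\<F>. finite \<F> \<and> \<F> \<subseteq> U ` topspace K1 \<and> topspace K1 \<subseteq> \<Union>\<F>"
    using U(1,2) by (intro compactinD) (use K1 in \<open>auto simp: compact_space_def\<close>)
  then obtain J where J: "finite J" "J \<subseteq> topspace K1" "topspace K1 \<subseteq> (\<Union>j\<in>J. U j)"
    by (metis finite_subset_image)
  then have "\<forall>x\<in>topspace K1. \<exists>j\<in>J. x \<in> U j" by blast
  then obtain r where r: "\<And>x. x \<in> topspace K1 \<Longrightarrow> r x \<in> J \<and> x \<in> U (r x)" by metis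
  show thesis
  proof (rule that[of J r])
    show "\<bar>h (x, y) - h (r x, y)\<bar> < e" if "x \<in> topspace K1" "y \<in> topspace K2" for x y
      using U(3)[of "r x" x y] r[OF that(1)] J(2) that by auto
  qed (use J r in auto)
qed

lemma compact_bdd_on:
  assumes "compact_space X" "continuous_map X euclideanreal f"
  shows "bdd_on (topspace X) f"
proof -
  have "compact (f ` topspace X)"
    using image_compactin[of X "topspace X" euclideanreal f] assms by (simp add: compact_space_def)
  then show ?thesis using compact_imp_bounded by (force simp: bounded_iff bdd_on_def)
qed

text \<open>Replacing the slice at \<open>x\<close> by the slice at \<open>r x\<close> turns
  \<open>h\<close> into a finite sum of tensors, with the indicators of the fibres of
  \<open>r\<close> as first factors.\<close>

lemma avg_converges_continuous:
  assumes 1: "torus_mean (topspace K1) m1 I g1" and 2: "torus_mean (topspace K2) m2 I g2"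
    and K1: "compact_space K1" and K2: "compact_space K2"
    and h: "continuous_map (prod_topology K1 K2) euclideanreal h"
  shows "torus_mean.avg_converges (topspace K1 \<times> topspace K2) (\<lambda>h. m1 (\<lambda>x. m2 (\<lambda>y. h (x, y)))) I 
    (\<lambda>(x, y) i. g1 x i + g2 y i) h"
proof -
  interpret torus_mean "topspace K1 \<times> topspace K2" "\<lambda>h. m1 (\<lambda>x. m2 (\<lambda>y. h (x, y)))" I "\<lambda>(x, y) i. g1 x i + g2 y i"
    by (rule torus_mean_prod[OF 1 2])
  have h_bdd: "bdd_on (topspace K1 \<times> topspace K2) h"
    using compact_bdd_on[OF _ h] K1 K2 by (simp add: compact_space_prod_topology)
  show ?thesis
  proof (rule avg_converges_closure[OF h_bdd])
    fix e :: real assume "e > 0"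
    then obtain J r where J: "finite J" "J \<subseteq> topspace K1" "\<And>x. x \<in> topspace K1 \<Longrightarrow> r x \<in> J"
      and close: "\<And>x y. x \<in> topspace K1 \<Longrightarrow> y \<in> topspace K2 \<Longrightarrow> \<bar>h (x, y) - h (r x, y)\<bar> < e"
      using compact_slices_approx[OF K1 K2 h] by metis
    let ?f = "\<lambda>v. \<Sum>j\<in>J. (\<lambda>(x, y). of_bool (r x = j) * h (j, y)) v"
    have "avg_converges ?f"
    proof (intro avg_converges_sum avg_converges_rank_one 1 2)
      fix j assume "j \<in> J"
      show "bdd_on (topspace K1) (\<lambda>x. of_bool (r x = j))" by (rule bdd_onI[of _ _ 1]) auto
      show "bdd_on (topspace K2) (\<lambda>y. h (j, y))" using h_bdd \<open>j \<in> J\<close> J(2) by (auto simp: bdd_on_def)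
    qed
    moreover have "\<bar>h v - ?f v\<bar> \<le> e" if v: "v \<in> topspace K1 \<times> topspace K2" for v
    proof -
      obtain x y where v': "v = (x, y)" "x \<in> topspace K1" "y \<in> topspace K2" using v by auto
      have "?f v = (\<Sum>j\<in>J. if j = r x then h (j, y) else 0)" by (auto simp: v' intro!: sum.cong)
      also have "\<dots> = h (r x, y)" using J v' by simp
      finally show ?thesis using close[OF v'(2,3)] v' by auto
    qed
    ultimately show "\<exists>f. avg_converges f \<and> (\<forall>v\<in>topspace K1 \<times> topspace K2. \<bar>h v - f v\<bar> \<le> e)" by blast
  qed
qed

section \<open>Trigonometric polynomials and the cube\<close>

text \<open>Real trigonometric polynomials; the shift \<open>c\<close> also covers sines.\<close>

inductive trig_poly :: "'i set \<Rightarrow> (('i \<Rightarrow> real) \<Rightarrow> real) \<Rightarrow> bool" for I where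
  cos: "k \<in> freqs I \<Longrightarrow> trig_poly I (\<lambda>z. a * cos (phase k z + c))"
| add: "trig_poly I f \<Longrightarrow> trig_poly I g \<Longrightarrow> trig_poly I (\<lambda>z. f z + g z)"

lemma trig_poly_const: "trig_poly I (\<lambda>_. a)"
  using trig_poly.cos[OF freqs_0, of I a 0] by simp

text \<open>The product-to-sum formula for two cosines, extended bilinearly by induction on both
  factors. It is what makes the class an algebra for Stone-Weierstrass.\<close>

lemma trig_poly_mult:
  assumes "trig_poly I f" "trig_poly I g"
  shows "trig_poly I (\<lambda>z. f z * g z)"
  using assms
proof (induction arbitrary: g rule: trig_poly.induct)
  case (cos k a c)
  note k = cos(1)
  from cos(2) show ?case
  proof (induction rule: trig_poly.induct)
    case (cos n b d)
    have "a * cos (phase k z + c) * (b * cos (phase n z + d)) =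
      a * b / 2 * cos (phase (\<lambda>i. k i - n i) z + (c - d)) + a * b / 2 * cos (phase (\<lambda>i. k i + n i) z + (c + d))" for z
    proof -
      have "a * cos (phase k z + c) * (b * cos (phase n z + d)) = 
        a * b * (cos (phase k z + c) * cos (phase n z + d))" by simp
      also have "\<dots> = a * b * ((cos (phase k z - phase n z + (c - d)) + cos (phase k z + phase n z + (c + d))) / 2)"
        by (simp add: cos_times_cos algebra_simps)
      finally show ?thesis 
        by (simp add: phase_freq_diff[OF k cos] phase_freq_add[OF k cos] field_simps)
    qed
    then show ?case
      by (simp only:) (intro trig_poly.intros freqs_add freqs_diff k cos)
  qed (simp add: distrib_left trig_poly.add)
qed (simp add: distrib_right trig_poly.add)

text \<open>The linear extension of \<open>avg_cos_tendsto\<close>; boundedness is carried through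
  the induction because \<open>avg_add\<close> asks for it.\<close>

lemma (in torus_mean) avg_trig_poly_tendsto:
  assumes "trig_poly I q"
  shows "((\<lambda>A. avg A (\<lambda>x. q (w x)) z) \<longlongrightarrow> q z) (fejer_filter I) \<and> bdd_on X (\<lambda>x. q (w x))"
  using assms
proof induction
  case (cos k a c)
  have "((\<lambda>A. a * avg A (\<lambda>x. cos (phase k (w x) + c)) z) \<longlongrightarrow> a * cos (phase k z + c)) (fejer_filter I)"
    by (intro tendsto_intros avg_cos_tendsto cos)
  moreover have "\<forall>\<^sub>F A in fejer_filter I. a * avg A (\<lambda>x. cos (phase k (w x) + c)) z
      = avg A (\<lambda>x. a * cos (phase k (w x) + c)) z"
    by (rule eventually_mono[OF eventually_finite_fst]) (simp add: avg_scale)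
  ultimately show ?case by (auto dest: Lim_transform_eventually)
next
  case (add f g)
  have "((\<lambda>A. avg A (\<lambda>x. f (w x)) z + avg A (\<lambda>x. g (w x)) z) \<longlongrightarrow> f z + g z) (fejer_filter I)"
    using add by (intro tendsto_intros) auto
  moreover have "\<forall>\<^sub>F A in fejer_filter I. avg A (\<lambda>x. f (w x)) z + avg A (\<lambda>x. g (w x)) z
      = avg A (\<lambda>x. f (w x) + g (w x)) z"
    by (rule eventually_mono[OF eventually_finite_fst]) (use add in \<open>simp add: avg_add\<close>)
  ultimately show ?case using add by (auto dest: Lim_transform_eventually)
qed

definition unit_cube :: "'i set \<Rightarrow> ('i \<Rightarrow> real) set" where
  "unit_cube I = (\<Pi>\<^sub>E i\<in>I. {0..1})"

lemma topspace_cube: "topspace (cube I) = unit_cube I"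
  by (simp add: cube_def unit_cube_def)

text \<open>Coordinates off \<open>I\<close> are pinned to \<open>undefined\<close>, so the set is a
  product of compact sets over the whole index type.\<close>

lemma compact_unit_cube: "compact (unit_cube I)"
proof -
  have "unit_cube I = (\<Pi>\<^sub>E i\<in>UNIV. if i \<in> I then {0..1} else {undefined})"
    by (auto simp: unit_cube_def PiE_iff extensional_def split: if_splits)
  moreover have "compactin (product_topology (\<lambda>_. euclideanreal) UNIV)
     (\<Pi>\<^sub>E i\<in>UNIV. if i \<in> I then {0..1} else {undefined})"
    unfolding compactin_PiE by simp
  ultimately show ?thesis by (simp add: euclidean_product_topology)
qed

text \<open>The identity is continuous both ways between \<open>cube I\<close> and
  \<open>unit_cube I\<close> as a subspace of the function type, the coordinates off
  \<open>I\<close> being constant. This moves the problem to where Stone-Weierstrass and the uniform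
  limit theorem apply.\<close>

lemma continuous_map_cube_iff:
  "continuous_map (cube I) euclideanreal f \<longleftrightarrow> continuous_on (unit_cube I) f"
proof -
  have 1: "continuous_map (cube I) (top_of_set (unit_cube I)) (\<lambda>t. t)"
  proof -
    have "continuous_map (cube I) euclidean (\<lambda>t. t i)" for i
    proof (cases "i \<in> I")
      case True
      then have "continuous_map (cube I) (top_of_set {0..1}) (\<lambda>t. t i)"
        unfolding cube_def by (rule continuous_map_product_projection)
      then show ?thesis using continuous_map_in_subtopology by blast
    next
      case False
      show ?thesis
      proof (rule continuous_map_eq)
        show "continuous_map (cube I) euclidean (\<lambda>_. undefined :: real)" by simp
        show "undefined = t i" if "t \<in> topspace (cube I)" for t
          using PiE_arb[of t I "\<lambda>_. {0..1}" i] that False by (simp add: topspace_cube unit_cube_def)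
      qed
    qed
    then have "continuous_map (cube I) (product_topology (\<lambda>_. euclideanreal) UNIV) (\<lambda>t. t)"
      by (simp add: continuous_map_componentwise)
    then show ?thesis
      by (simp add: euclidean_product_topology continuous_map_in_subtopology topspace_cube)
  qed
  have 2: "continuous_map (top_of_set (unit_cube I)) (cube I) (\<lambda>t. t)"
    unfolding cube_def continuous_map_componentwise
    by (auto simp: unit_cube_def continuous_map_in_subtopology PiE_iff intro!: continuous_on_apply)
  show ?thesis
    using continuous_map_compose[OF 1, of euclideanreal f] continuous_map_compose[OF 2, of euclideanreal f]
    by (auto simp: o_def)
qed

text \<open>A folding of the torus onto the cube, and a section of it. The cosine makes polynomials on the cube
  pull back to trigonometric polynomials.\<close>

definition fold_cube :: "'i set \<Rightarrow> ('i \<Rightarrow> real) \<Rightarrow> 'i \<Rightarrow> real" where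
  "fold_cube I z = (\<lambda>i\<in>I. (1 - cos (2 * pi * z i)) / 2)"

definition unfold_cube :: "('i \<Rightarrow> real) \<Rightarrow> 'i \<Rightarrow> real" where
  "unfold_cube t i = arccos (1 - 2 * t i) / (2 * pi)"

lemma fold_cube_in_unit_cube: "fold_cube I z \<in> unit_cube I"
proof -
  have "(1 - cos (2 * pi * z i)) / 2 \<in> {0..1}" for i
    using cos_le_one[of "2 * pi * z i"] cos_ge_minus_one[of "2 * pi * z i"] by auto
  then show ?thesis by (auto simp: fold_cube_def unit_cube_def)
qed

lemma fold_cube_unfold_cube: "t \<in> unit_cube I \<Longrightarrow> fold_cube I (unfold_cube t) = t"
  by (auto simp: fold_cube_def unfold_cube_def unit_cube_def fun_eq_iff PiE_iff extensional_def)

text \<open>Separating open sets pull back along a coordinate in which two functions differ. The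
  chain of instances up to \<open>t2_space\<close> prepares Stone-Weierstrass on
  \<open>unit_cube I\<close>.\<close>

instance "fun" :: (type, t0_space) t0_space
proof
  fix f g :: "'a \<Rightarrow> 'b" assume "f \<noteq> g"
  then obtain i where i: "f i \<noteq> g i" by auto
  then obtain U where "open U" "\<not> (f i \<in> U \<longleftrightarrow> g i \<in> U)"
    using t0_space_class.t0_space[OF i] by blast
  then show "\<exists>U. open U \<and> \<not> (f \<in> U \<longleftrightarrow> g \<in> U)"
    by (intro exI[of _ "(\<lambda>f. f i) -` U"]) (auto intro!: open_vimage continuous_on_product_coordinates)
qed

instance "fun" :: (type, t1_space) t1_space
proof
  fix f g :: "'a \<Rightarrow> 'b" assume "f \<noteq> g"
  then obtain i where i: "f i \<noteq> g i" by auto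
  then obtain U where "open U" "f i \<in> U" "g i \<notin> U"
    using t1_space_class.t1_space[OF i] by blast
  then show "\<exists>U. open U \<and> f \<in> U \<and> g \<notin> U"
    by (intro exI[of _ "(\<lambda>f. f i) -` U"]) (auto intro!: open_vimage continuous_on_product_coordinates)
qed

instance "fun" :: (type, t2_space) t2_space
proof
  fix f g :: "'a \<Rightarrow> 'b" assume "f \<noteq> g"
  then obtain i where i: "f i \<noteq> g i" by auto
  then obtain U V where "open U" "open V" "f i \<in> U" "g i \<in> V" "U \<inter> V = {}"
    using hausdorff[OF i] by blast
  then show "\<exists>U V. open U \<and> open V \<and> f \<in> U \<and> g \<in> V \<and> U \<inter> V = {}"
    by (intro exI[of _ "(\<lambda>f. f i) -` U"] exI[of _ "(\<lambda>f. f i) -` V"])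
      (auto intro!: open_vimage continuous_on_product_coordinates)
qed

text \<open>Stone-Weierstrass for the algebra \<open>R\<close> of continuous functions on the cube
  whose pullback along the folding is a trigonometric polynomial.\<close>

lemma cube_trig_approx:
  assumes f: "continuous_on (unit_cube I) f" and e: "e > 0"
  obtains q where "trig_poly I q" "\<And>z. \<bar>f (fold_cube I z) - q z\<bar> < e"
proof -
  define R where "R = {f. continuous_on (unit_cube I) f \<and> trig_poly I (\<lambda>z. f (fold_cube I z))}"
  interpret function_ring_on R "unit_cube I"
  proof
    show "compact (unit_cube I)" by (rule compact_unit_cube)
    show "\<exists>f\<in>R. f s \<noteq> f t" if "s \<in> unit_cube I" "t \<in> unit_cube I" "s \<noteq> t" for s t
    proof -
      have "\<exists>i\<in>I. s i \<noteq> t i"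
      proof (rule ccontr)
        assume "\<not> (\<exists>i\<in>I. s i \<noteq> t i)"
        then have "s = t" using that(1,2) unfolding unit_cube_def by (intro PiE_ext) auto
        with that(3) show False by simp
      qed
      then obtain i where i: "i \<in> I" "s i \<noteq> t i" by blast
      \<comment> \<open>The unit frequency in direction \<open>i\<close>: the coordinate function
        \<open>t i\<close> pulls back to \<open>(1 - cos (phase k z)) / 2\<close>, so the separating
        coordinate lies in \<open>R\<close>.\<close>
      define k where "k = (\<lambda>j. if j = i then 1 else 0 :: int)"
      have k: "k \<in> freqs I" "phase k z = 2 * pi * z i" for z
        using i by (auto simp: k_def freqs_def phase_def)
      have "trig_poly I (\<lambda>z. 1/2 + (- 1/2) * cos (phase k z + 0))"
        by (intro trig_poly.intros trig_poly_const k)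
      then have "trig_poly I (\<lambda>z. fold_cube I z i)"
        using i by (simp add: fold_cube_def k diff_divide_distrib)
      then have "(\<lambda>t. t i) \<in> R" by (auto simp: R_def intro: continuous_on_apply)
      then show ?thesis using i(2) by (intro bexI[of "\<lambda>f. f s \<noteq> f t" "\<lambda>t. t i"])
    qed
    show "(\<lambda>t. f t + g t) \<in> R" "(\<lambda>t. f t * g t) \<in> R" if "f \<in> R" "g \<in> R" for f g
      using that by (simp_all add: R_def continuous_on_add continuous_on_mult trig_poly.add trig_poly_mult)
  qed (simp_all add: R_def trig_poly_const)
  obtain g where "g \<in> R" "\<forall>t\<in>unit_cube I. \<bar>f t - g t\<bar> < e" using Stone_Weierstrass_basic[OF f e] by blast
  then show thesis by (intro that[of "\<lambda>z. g (fold_cube I z)"]) (simp_all add: R_def fold_cube_in_unit_cube)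
qed

text \<open>The claim holds for trigonometric polynomials, and the contraction property passes it on
  to their uniform limits. It will show that the left inverse recovers \<open>f\<close>.\<close>

lemma (in torus_mean) avg_fold_cube_tendsto:
  assumes f: "continuous_on (unit_cube I) f"
  shows "((\<lambda>A. avg A (\<lambda>x. f (fold_cube I (w x))) z) \<longlongrightarrow> f (fold_cube I z)) (fejer_filter I)"
proof (rule tendstoI)
  fix e :: real assume e: "e > 0"
  obtain q where q: "trig_poly I q" "\<And>z. \<bar>f (fold_cube I z) - q z\<bar> < e / 3"
    using cube_trig_approx[OF f, of "e / 3"] e by auto
  have "bounded (f ` unit_cube I)"
    using compact_continuous_image[OF f compact_unit_cube] compact_imp_bounded by blast
  then have "bdd_on X (\<lambda>x. f (fold_cube I (w x)))"
    using fold_cube_in_unit_cube by (fastforce simp: bounded_iff bdd_on_def)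
  moreover have "bdd_on X (\<lambda>x. q (w x))" using avg_trig_poly_tendsto[OF q(1)] by blast
  ultimately have "\<forall>\<^sub>F A in fejer_filter I. \<forall>z. \<bar>avg A (\<lambda>x. f (fold_cube I (w x))) z - avg A (\<lambda>x. q (w x)) z\<bar> \<le> e / 3"
    using q(2) by (intro eventually_avg_close) (auto intro: less_imp_le)
  moreover have "\<forall>\<^sub>F A in fejer_filter I. dist (avg A (\<lambda>x. q (w x)) z) (q z) < e / 3"
    using avg_trig_poly_tendsto[OF q(1)] e by (intro tendstoD) auto
  ultimately show "\<forall>\<^sub>F A in fejer_filter I. dist (avg A (\<lambda>x. f (fold_cube I (w x))) z) (f (fold_cube I z)) < e"
  proof eventually_elim
    case (elim A)
    from elim(1)[rule_format, of z] elim(2) q(2)[of z] show ?case unfolding dist_real_def by linarith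
  qed
qed

text \<open>Only coordinates \<open>i \<in> I\<close> enter, and there \<open>1 - 2 * t i\<close>
  stays in \<open>[-1,1]\<close>, where \<open>arccos\<close> is continuous.\<close>

lemma continuous_on_phase_unfold_cube:
  assumes "n \<in> freqs I"
  shows "continuous_on (unit_cube I) (\<lambda>t. phase n (unfold_cube t))"
proof -
  have "t i \<in> {0..1}" if "n i \<noteq> 0" "t \<in> unit_cube I" for t i
  proof -
    have "i \<in> I" using assms that(1) by (auto simp: freqs_def)
    with that(2) show ?thesis unfolding unit_cube_def by (rule PiE_mem)
  qed
  then show ?thesis unfolding phase_def unfold_cube_def by (intro continuous_intros) simp_all
qed

text \<open>A uniform limit of finite trigonometric sums: the addition formula for the cosine
  separates the variable \<open>z\<close> from the mean over \<open>x\<close>.\<close>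

lemma (in torus_mean) continuous_on_lim_avg:
  assumes h: "avg_converges h"
  shows "continuous_on (unit_cube I) (\<lambda>t. lim_avg h (unfold_cube t))"
proof (rule uniform_limit_theorem)
  show "uniform_limit (unit_cube I) (\<lambda>A t. avg A h (unfold_cube t)) (\<lambda>t. lim_avg h (unfold_cube t)) (fejer_filter I)"
    by (intro uniform_limitI eventually_mono[OF uniform_limitD[OF uniform_limit_lim_avg[OF h]]]) auto
  show "\<forall>\<^sub>F A in fejer_filter I. continuous_on (unit_cube I) (\<lambda>t. avg A h (unfold_cube t))"
    using eventually_fejer_filter_finite
  proof eventually_elim
    case (elim A)
    obtain F N where A: "A = (F, N)" by force
    have hb: "bdd_on X h" using h by (simp add: avg_converges_def)
    have "m (\<lambda>x. h x * cos (phase n z - phase n (w x))) = 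
      cos (phase n z) * m (\<lambda>x. h x * cos (phase n (w x))) + sin (phase n z) * m (\<lambda>x. h x * sin (phase n (w x)))" for n z
    proof -
      have "m (\<lambda>x. h x * cos (phase n z - phase n (w x))) = 
        m (\<lambda>x. cos (phase n z) * (h x * cos (phase n (w x))) + sin (phase n z) * (h x * sin (phase n (w x))))"
        by (simp add: cos_diff algebra_simps)
      then show ?thesis using hb by (simp add: add scale bdd_on_intros)
    qed
    then have "avg A h (unfold_cube t) = (\<Sum>n\<in>grid_diffs F N. fejer_coeff F N n * (
       cos (phase n (unfold_cube t)) * m (\<lambda>x. h x * cos (phase n (w x))) + 
       sin (phase n (unfold_cube t)) * m (\<lambda>x. h x * sin (phase n (w x)))))" for t
      using elim hb by (simp add: A avg_expand)
    moreover have "grid_diffs F N \<subseteq> freqs I" using elim grid_diffs_subset by (auto simp: A)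
    ultimately show ?case
      by (auto intro!: continuous_intros continuous_on_phase_unfold_cube)
  qed
qed (rule fejer_filter_neq_bot)

section \<open>The complemented copy\<close>

lemma supnorm_leI:
  assumes "topspace X \<noteq> {}" "\<And>x. x \<in> topspace X \<Longrightarrow> \<bar>f x\<bar> \<le> B"
  shows "supnorm X f \<le> B"
  unfolding supnorm_def using assms by (intro cSUP_least) auto

lemma abs_le_supnorm:
  assumes "bdd_on (topspace X) f" "x \<in> topspace X"
  shows "\<bar>f x\<bar> \<le> supnorm X f"
  unfolding supnorm_def using assms by (intro cSUP_upper) (auto simp: bdd_on_def bdd_above_def)

text \<open>\<open>T \<circ> S\<close> is the projection onto the range of \<open>T\<close>. Since
  \<open>S\<close> is a contraction with \<open>S (T f) = f\<close>, the norm of \<open>T f\<close>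
  is at least that of \<open>f\<close>, so \<open>T\<close> is isometric and all constants are
  1.\<close>

lemma has_complemented_copyI:
  assumes T: "lin_on (cspace Y) (cspace X) T" and S: "lin_on (cspace X) (cspace Y) S"
    and ST: "\<And>f. f \<in> cspace Y \<Longrightarrow> S (T f) = f"
    and T_le: "\<And>f. f \<in> cspace Y \<Longrightarrow> supnorm X (T f) \<le> supnorm Y f"
    and S_le: "\<And>h. h \<in> cspace X \<Longrightarrow> supnorm Y (S h) \<le> supnorm X h"
  shows "has_complemented_copy X Y"
  unfolding has_complemented_copy_def
proof (intro exI conjI)
  have TX: "T f \<in> cspace X" if "f \<in> cspace Y" for f using T that by (auto simp: lin_on_def)
  have SY: "S h \<in> cspace Y" if "h \<in> cspace X" for h using S that by (auto simp: lin_on_def)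
  show "T ` cspace Y \<subseteq> cspace X" using TX by auto
  show "lin_on (cspace X) (cspace X) (\<lambda>h. T (S h))"
    using S T SY TX unfolding lin_on_def by (simp add: image_subset_iff)
  show "\<forall>h\<in>cspace X. supnorm X (T (S h)) \<le> 1 * supnorm X h"
    using T_le S_le SY by (force intro: order_trans)
  show "(\<lambda>h. T (S h)) ` cspace X = T ` cspace Y"
    using SY TX ST by (force simp: image_iff)
  show "\<forall>f\<in>T ` cspace Y. T (S f) = f" using ST by auto
  show "lin_on (cspace Y) (cspace X) T" by (rule T)
  show "T ` cspace Y = T ` cspace Y" ..
  show "(1::real) > 0" by simp
  show "\<forall>f\<in>cspace Y. 1 * supnorm Y f \<le> supnorm X (T f) \<and> supnorm X (T f) \<le> 1 * supnorm Y f"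
    using T_le S_le[OF TX] ST by simp
qed

theorem theorem1p2:
  fixes K1 :: "'a topology" and K2 :: "'b topology" and I :: "'i set"
  assumes "compact_space K1" "Hausdorff_space K1"
    and "compact_space K2" "Hausdorff_space K2"
    and "I \<noteq> {}"
    and "\<exists>g. continuous_map K1 (cube I) g \<and> g ` topspace K1 = topspace (cube I)"
    and "\<exists>g. continuous_map K2 (cube I) g \<and> g ` topspace K2 = topspace (cube I)"
  shows "has_complemented_copy (prod_topology K1 K2) (cube I)"
proof -
  from assms(6,7) obtain g1 g2 where 
    g1: "continuous_map K1 (cube I) g1" "g1 ` topspace K1 = unit_cube I" and
    g2: "continuous_map K2 (cube I) g2" "g2 ` topspace K2 = unit_cube I"
    by (auto simp: topspace_cube)
  have "\<exists>x\<in>topspace K1. g1 x = a" if "a \<in> (\<Pi>\<^sub>E i\<in>I. {0..1})" for a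
  proof -
    have "a \<in> g1 ` topspace K1" using that by (simp only: g1(2) unit_cube_def)
    then show ?thesis by auto
  qed
  then obtain m1 where m1: "mean (topspace K1) m1" "equidistributed I m1 g1"
    by (rule mean_exists)
  have "\<exists>x\<in>topspace K2. g2 x = a" if "a \<in> (\<Pi>\<^sub>E i\<in>I. {0..1})" for a
  proof -
    have "a \<in> g2 ` topspace K2" using that by (simp only: g2(2) unit_cube_def)
    then show ?thesis by auto
  qed
  then obtain m2 where m2: "mean (topspace K2) m2" "equidistributed I m2 g2"
    by (rule mean_exists)
  have tm: "torus_mean (topspace K1) m1 I g1" "torus_mean (topspace K2) m2 I g2"
    using m1 m2 by (simp_all add: torus_mean_def torus_mean_axioms_def)
  define V where "V = topspace K1 \<times> topspace K2"
  define m where "m = (\<lambda>h. m1 (\<lambda>x. m2 (\<lambda>y. h (x, y))))"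
  \<comment> \<open>A real lift of the sum in the torus; changing it by integers affects neither the
    characters nor \<open>fold_cube\<close>.\<close>
  define w where "w = (\<lambda>(x, y) i. g1 x i + g2 y i)"
  interpret torus_mean V m I w
    unfolding V_def m_def w_def by (rule torus_mean_prod[OF tm])
  let ?X = "prod_topology K1 K2"
  have X: "topspace ?X = V" by (simp add: V_def)
  have conv: "avg_converges h" if "h \<in> cspace ?X" for h
    using avg_converges_continuous[OF tm assms(1,3), of h] that by (simp add: cspace_def V_def m_def w_def)
  have fold_w: "continuous_map ?X (cube I) (\<lambda>v. fold_cube I (w v))"
  proof -
    have "continuous_map ?X euclideanreal (\<lambda>v. w v i)" if i: "i \<in> I" for i
    proof -
      have p: "continuous_map (cube I) euclideanreal (\<lambda>t. t i)"
        unfolding continuous_map_cube_iff by (rule continuous_on_apply)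
      have "continuous_map ?X euclideanreal (\<lambda>v. g1 (fst v) i)"
        using continuous_map_compose[OF continuous_map_compose[OF continuous_map_fst g1(1)] p] by (simp add: o_def)
      moreover have "continuous_map ?X euclideanreal (\<lambda>v. g2 (snd v) i)"
        using continuous_map_compose[OF continuous_map_compose[OF continuous_map_snd g2(1)] p] by (simp add: o_def)
      ultimately show ?thesis by (simp add: w_def case_prod_unfold continuous_map_add)
    qed
    moreover have "continuous_map euclideanreal (top_of_set {0..1}) (\<lambda>a. (1 - cos (2 * pi * a)) / 2)"
      using cos_le_one cos_ge_minus_one
      by (auto simp: continuous_map_in_subtopology intro!: continuous_intros)
    ultimately have "continuous_map ?X (top_of_set {0..1}) (\<lambda>v. (1 - cos (2 * pi * w v i)) / 2)" if "i \<in> I" for i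
      using continuous_map_compose[of ?X euclideanreal "\<lambda>v. w v i"] that by (fastforce simp: o_def)
    then show ?thesis
      unfolding cube_def continuous_map_componentwise by (auto simp: fold_cube_def)
  qed
  have fold_mem: "fold_cube I z \<in> topspace (cube I)" for z by (simp add: topspace_cube fold_cube_in_unit_cube)
  \<comment> \<open>The norm estimates below go through \<open>supnorm_leI\<close>, which needs
    nonempty spaces because the supremum over the empty set is not meaningful.\<close>
  have ne: "topspace (cube I) \<noteq> {}" using fold_mem by blast
  have V_ne: "V \<noteq> {}"
  proof -
    have "unit_cube I \<noteq> {}" using ne by (simp add: topspace_cube)
    then show ?thesis using g1(2) g2(2) by (auto simp: V_def)
  qed
  have cube_compact: "compact_space (cube I)"
    by (simp add: cube_def compact_space_product_topology compact_space_subtopology)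
  \<comment> \<open>The embedding composes with the folded sum; its left inverse \<open>S\<close>
    evaluates the limit density on the section. Both are cut off to 0 outside the space, as
    \<open>cspace\<close> prescribes.\<close>
  define T where "T f = (\<lambda>v. if v \<in> V then f (fold_cube I (w v)) else 0)" for f :: "('i \<Rightarrow> real) \<Rightarrow> real"
  define S where "S h = (\<lambda>t. if t \<in> unit_cube I then lim_avg h (unfold_cube t) else 0)" for h
  have bddX: "bdd_on V h" if "h \<in> cspace ?X" for h using conv[OF that] by (simp add: avg_converges_def)
  have bddC: "bdd_on (topspace (cube I)) f" if "f \<in> cspace (cube I)" for f
    using compact_bdd_on[OF cube_compact] that by (simp add: cspace_def)
  have TX: "T f \<in> cspace ?X" if "f \<in> cspace (cube I)" for f
  proof -
    have "continuous_map ?X euclideanreal (\<lambda>v. f (fold_cube I (w v)))"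
      using continuous_map_compose[OF fold_w, of euclideanreal f] that by (simp add: cspace_def o_def)
    then have "continuous_map ?X euclideanreal (T f)"
      by (rule continuous_map_eq) (simp add: T_def V_def)
    then show ?thesis by (simp add: cspace_def T_def V_def)
  qed
  have SC: "S h \<in> cspace (cube I)" if "h \<in> cspace ?X" for h
  proof -
    have "continuous_on (unit_cube I) (S h)"
      using continuous_on_lim_avg[OF conv[OF that]] by (rule continuous_on_eq) (simp add: S_def)
    then show ?thesis by (simp add: cspace_def continuous_map_cube_iff S_def topspace_cube)
  qed
  show ?thesis
  proof (rule has_complemented_copyI)
    show "lin_on (cspace (cube I)) (cspace ?X) T"
      using TX by (auto simp: lin_on_def T_def)
    show "lin_on (cspace ?X) (cspace (cube I)) S"
      unfolding lin_on_def
    proof (intro conjI ballI allI ext)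
      show "S ` cspace ?X \<subseteq> cspace (cube I)" using SC by auto
      fix f t c assume f: "f \<in> cspace ?X"
      show "S (\<lambda>v. c * f v) t = c * S f t" using lim_avg_scale[OF conv[OF f]] by (simp add: S_def)
      fix g assume g: "g \<in> cspace ?X"
      show "S (\<lambda>v. f v + g v) t = S f t + S g t"
        using avg_converges_add(2)[OF conv[OF f] conv[OF g]] by (simp add: S_def)
    qed
    show "S (T f) = f" if f: "f \<in> cspace (cube I)" for f
    proof
      fix t
      show "S (T f) t = f t"
      proof (cases "t \<in> unit_cube I")
        case True
        have "avg A (T f) z = avg A (\<lambda>v. f (fold_cube I (w v))) z" if "finite (fst A)" for A z
          unfolding avg_def using bddX[OF TX[OF f]] that by (intro cong_on) (auto simp: T_def)
        then have "\<forall>\<^sub>F A in fejer_filter I. avg A (\<lambda>v. f (fold_cube I (w v))) (unfold_cube t) = avg A (T f) (unfold_cube t)"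
          by (intro eventually_mono[OF eventually_finite_fst]) simp
        moreover have "((\<lambda>A. avg A (\<lambda>v. f (fold_cube I (w v))) (unfold_cube t)) \<longlongrightarrow> f (fold_cube I (unfold_cube t))) (fejer_filter I)"
          using f by (intro avg_fold_cube_tendsto) (simp add: cspace_def continuous_map_cube_iff)
        ultimately have "((\<lambda>A. avg A (T f) (unfold_cube t)) \<longlongrightarrow> f t) (fejer_filter I)"
          using Lim_transform_eventually fold_cube_unfold_cube[OF True] by fastforce
        then show ?thesis using True by (simp add: S_def lim_avg_eqI)
      next
        case False
        then show ?thesis using f by (simp add: S_def cspace_def topspace_cube)
      qed
    qed
    show "supnorm ?X (T f) \<le> supnorm (cube I) f" if "f \<in> cspace (cube I)" for f
    proof (rule supnorm_leI)
      show "topspace ?X \<noteq> {}" using V_ne by (simp only: X not_False_eq_True)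
      show "\<bar>T f v\<bar> \<le> supnorm (cube I) f" if "v \<in> topspace ?X" for v
        using abs_le_supnorm[OF bddC[OF \<open>f \<in> cspace (cube I)\<close>] fold_mem] that unfolding X T_def by simp
    qed
    show "supnorm (cube I) (S h) \<le> supnorm ?X h" if "h \<in> cspace ?X" for h
    proof (rule supnorm_leI[OF ne])
      have "\<bar>h v\<bar> \<le> supnorm ?X h" if "v \<in> V" for v
        using abs_le_supnorm[of ?X h v] bddX[OF \<open>h \<in> cspace ?X\<close>] that by (simp only: X)
      then have "\<bar>lim_avg h z\<bar> \<le> supnorm ?X h" for z by (rule abs_lim_avg_le[OF conv[OF that]])
      then show "\<bar>S h t\<bar> \<le> supnorm ?X h" if "t \<in> topspace (cube I)" for t
        using that by (simp add: S_def topspace_cube)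
    qed
  qed
qed

end
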